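(* Let $K$ be a field, $H$ a numerical semigroup, and $R=K[|H|]$ the numerical semigroup ring. If $R$ is a far-flung Gorenstein ring, then \[ \mathrm e(R)\le \overline n(r), \] where $r=\mathrm r(R)$ is the Cohen-Macaulay type of $R$ and $\overline n(r)$ is the solution of the Rohrbach problem for $r$.
   Context: A numerical semigroup is a submonoid $H$ of $\mathbb N_0=\{0,1,2,\dots\}$ with $\mathbb N_0\setminus H$ finite; $K[|H|]=K[|t^h:h\in H|]$ is the subring of the formal power series ring $K[|t|]$ consisting of series supported on $H$. It is a one-dimensional Cohen-Macaulay local domain with canonical module $\omega_R$ and integral closure $\overline R=K[|t|]$. $R$ is called far-flung Gorenstein if $\mathrm{tr}_R(\omega_R)=R:\overline R$, where $\mathrm{tr}_R(\omega_R)=\sum_{f\in\mathrm{Hom}_R(\omega_R,R)}\mathrm{Im}\,f$ and $R:\overline R=\{\alpha\in Q(R):\alpha\overline R\subseteq R\}$ ($Q(R)$ the fraction field). $\mathrm e(R)$ is the multiplicity of $R$ (equal to the smallest nonzero element of $H$). Rohrbach problem: for a set $A$ of non-negative integers with $r$ elements, let $n(A)$ be the integer such that the sum-set $A+A=\{a+b:a,b\in A\}$ contains $0,1,\dots,n(A)-1$ but not $n(A)$; if $0\notin A$ put $n(A)=-1$. For $r>0$, $\overline n(r)=\max\{n(A): |A|=r\}$. *)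

theory Defs
  imports
    "HOL-Algebra.Module"
    "HOL-Algebra.Ideal_Product"
    "HOL-Library.Extended_Nat"
    "HOL-Computational_Algebra.Formal_Laurent_Series"
begin

section \<open>Modules over a commutative ring\<close>

definition ring_module :: "'a ring \<Rightarrow> ('a, 'a) module" where
  "ring_module R = \<lparr>carrier = carrier R, monoid.mult = monoid.mult R, one = one R,
                    zero = zero R, add = add R, module.smult = monoid.mult R\<rparr>"

lemma ring_module_is_module:
  assumes "cring R"
  shows "Module.module R (ring_module R)"
proof -
  interpret cring R by fact
  have "abelian_group (ring_module R)"
  proof (rule abelian_groupI)
    fix x
    assume "x \<in> carrier (ring_module R)"
    then show "\<exists>y\<in>carrier (ring_module R). y \<oplus>\<^bsub>ring_module R\<^esub> x = \<zero>\<^bsub>ring_module R\<^esub>"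
      by (intro bexI[of _ "\<ominus>\<^bsub>R\<^esub> x"]) (simp_all add: ring_module_def l_neg)
  qed (simp_all add: ring_module_def a_ac)
  then show ?thesis
    by (intro Module.moduleI) (simp_all add: ring_module_def assms l_distr r_distr m_assoc)
qed

definition mod_hom :: "'a ring \<Rightarrow> ('a, 'b) module \<Rightarrow> ('a, 'c) module \<Rightarrow> ('b \<Rightarrow> 'c) set" where
  "mod_hom R M N =
     {f. f ` carrier M \<subseteq> carrier N \<and>
         (\<forall>x\<in>carrier M. \<forall>y\<in>carrier M. f (x \<oplus>\<^bsub>M\<^esub> y) = f x \<oplus>\<^bsub>N\<^esub> f y) \<and>
         (\<forall>a\<in>carrier R. \<forall>x\<in>carrier M. f (a \<odot>\<^bsub>M\<^esub> x) = a \<odot>\<^bsub>N\<^esub> f x)}"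

definition submodule_span :: "'a ring \<Rightarrow> ('a, 'b) module \<Rightarrow> 'b set \<Rightarrow> 'b set" where
  "submodule_span R M S = \<Inter>{N. submodule N R M \<and> S \<subseteq> N}"

definition fin_gen :: "'a ring \<Rightarrow> ('a, 'b) module \<Rightarrow> bool" where
  "fin_gen R M \<longleftrightarrow> (\<exists>S. finite S \<and> S \<subseteq> carrier M \<and> submodule_span R M S = carrier M)"

text \<open>The length of the quotient module \<open>B / A\<close>, for submodules \<open>A \<subseteq> B\<close> of \<open>M\<close>: submodules of
  \<open>B / A\<close> are represented by the submodules of \<open>M\<close> between \<open>A\<close> and \<open>B\<close>.\<close>

definition quot_length :: "'a ring \<Rightarrow> ('a, 'b) module \<Rightarrow> 'b set \<Rightarrow> 'b set \<Rightarrow> enat" where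
  "quot_length R M A B =
     Sup {enat n | n. \<exists>c :: nat \<Rightarrow> 'b set.
            (\<forall>i\<le>n. submodule (c i) R M \<and> A \<subseteq> c i \<and> c i \<subseteq> B) \<and> (\<forall>i<n. c i \<subset> c (Suc i))}"

text \<open>The trace \<open>\<Sum>{Im f | f \<in> Hom(M, R)}\<close>; the sum of a family of ideals is the ideal
  generated by their union.\<close>

definition module_trace :: "'a ring \<Rightarrow> ('a, 'b) module \<Rightarrow> 'a set" where
  "module_trace R M = Idl\<^bsub>R\<^esub> (\<Union>f\<in>mod_hom R M (ring_module R). f ` carrier M)"


section \<open>Local rings: dimension, multiplicity, depth, type\<close>

text \<open>In what follows \<open>R\<close> is a Noetherian local ring.\<close>

definition max_ideal :: "'a ring \<Rightarrow> 'a set" where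
  "max_ideal R = carrier R - Units R"

definition krull_dim :: "'a ring \<Rightarrow> enat" where
  "krull_dim R =
     Sup {enat n | n. \<exists>P :: nat \<Rightarrow> 'a set.
            (\<forall>i\<le>n. primeideal (P i) R) \<and> (\<forall>i<n. P i \<subset> P (Suc i))}"

primrec ideal_power :: "'a ring \<Rightarrow> 'a set \<Rightarrow> nat \<Rightarrow> 'a set" where
  "ideal_power R I 0 = carrier R"
| "ideal_power R I (Suc n) = ideal_prod R I (ideal_power R I n)"

text \<open>The Hilbert--Samuel multiplicity, \<open>lim d! \<ell>(R / m^n) / n^d\<close> with \<open>d = dim R\<close>.\<close>

definition multiplicity_of_ring :: "'a ring \<Rightarrow> real" where
  "multiplicity_of_ring R =
     (let d = the_enat (krull_dim R) in
      lim (\<lambda>n. fact d *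
             real (the_enat (quot_length R (ring_module R)
                               (ideal_power R (max_ideal R) n) (carrier R))) / real n ^ d))"

definition seq_mult :: "'a ring \<Rightarrow> ('a, 'b) module \<Rightarrow> 'a list \<Rightarrow> 'b set" where
  "seq_mult R M xs = submodule_span R M {a \<odot>\<^bsub>M\<^esub> v | a v. a \<in> set xs \<and> v \<in> carrier M}"

definition regular_seq :: "'a ring \<Rightarrow> ('a, 'b) module \<Rightarrow> 'a list \<Rightarrow> bool" where
  "regular_seq R M xs \<longleftrightarrow>
     set xs \<subseteq> max_ideal R \<and>
     (\<forall>i<length xs. \<forall>v\<in>carrier M.
        (xs ! i) \<odot>\<^bsub>M\<^esub> v \<in> seq_mult R M (take i xs) \<longrightarrow> v \<in> seq_mult R M (take i xs)) \<and>
     seq_mult R M xs \<noteq> carrier M"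

definition module_depth :: "'a ring \<Rightarrow> ('a, 'b) module \<Rightarrow> enat" where
  "module_depth R M = Sup {enat (length xs) | xs. regular_seq R M xs}"

definition maximal_CM_module :: "'a ring \<Rightarrow> ('a, 'b) module \<Rightarrow> bool" where
  "maximal_CM_module R M \<longleftrightarrow> Module.module R M \<and> fin_gen R M \<and> module_depth R M = krull_dim R"

text \<open>The Cohen--Macaulay type of a finitely generated module: the dimension over the residue
  field of the socle of \<open>M / (xs) M\<close>, for a maximal \<open>M\<close>-regular sequence \<open>xs\<close>.  It does not depend
  on \<open>xs\<close>.  The socle is killed by the maximal ideal, so this dimension is its length over \<open>R\<close>.\<close>

definition cm_type :: "'a ring \<Rightarrow> ('a, 'b) module \<Rightarrow> enat" where
  "cm_type R M =
     (let xs = (SOME xs. regular_seq R M xs \<and> enat (length xs) = module_depth R M) in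
      quot_length R M (seq_mult R M xs)
        {v \<in> carrier M. \<forall>a\<in>max_ideal R. a \<odot>\<^bsub>M\<^esub> v \<in> seq_mult R M xs})"


section \<open>Canonical modules\<close>

text \<open>Injectivity is expressed by Baer's criterion, since HOL cannot quantify over modules of all
  types: every homomorphism from an ideal of \<open>R\<close> extends to \<open>R\<close>.\<close>

definition injective_module :: "'a ring \<Rightarrow> ('a, 'b) module \<Rightarrow> bool" where
  "injective_module R E \<longleftrightarrow>
     Module.module R E \<and>
     (\<forall>I f. ideal I R \<longrightarrow> f \<in> mod_hom R ((ring_module R)\<lparr>carrier := I\<rparr>) E \<longrightarrow>
        (\<exists>g\<in>mod_hom R (ring_module R) E. \<forall>a\<in>I. g a = f a))"

text \<open>An injective resolution \<open>0 \<rightarrow> M \<rightarrow> E 0 \<rightarrow> E 1 \<rightarrow> \<dots>\<close> with \<open>E i = 0\<close> for all large \<open>i\<close>.  The type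
  argument gives the type in which the elements of the modules \<open>E i\<close> live; left free in the premise
  of a theorem, it amounts to an existential quantifier over all types.\<close>

definition finite_inj_dim :: "'e itself \<Rightarrow> 'a ring \<Rightarrow> ('a, 'b) module \<Rightarrow> bool" where
  "finite_inj_dim _ R M \<longleftrightarrow>
     (\<exists>(E :: nat \<Rightarrow> ('a, 'e) module) \<epsilon> d n.
        (\<forall>i. injective_module R (E i)) \<and>
        \<epsilon> \<in> mod_hom R M (E 0) \<and> inj_on \<epsilon> (carrier M) \<and>
        (\<forall>i. d i \<in> mod_hom R (E i) (E (Suc i))) \<and>
        \<epsilon> ` carrier M = {x \<in> carrier (E 0). d 0 x = \<zero>\<^bsub>E 1\<^esub>} \<and>
        (\<forall>i. d i ` carrier (E i) =
               {x \<in> carrier (E (Suc i)). d (Suc i) x = \<zero>\<^bsub>E (Suc (Suc i))\<^esub>}) \<and>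
        (\<forall>i>n. carrier (E i) = {\<zero>\<^bsub>E i\<^esub>}))"

text \<open>A canonical module of a Cohen--Macaulay local ring is a maximal Cohen--Macaulay module of
  type 1 and of finite injective dimension (Bruns and Herzog); it is unique up to isomorphism.\<close>

definition canonical_module :: "'e itself \<Rightarrow> 'a ring \<Rightarrow> ('a, 'b) module \<Rightarrow> bool" where
  "canonical_module T R W \<longleftrightarrow>
     maximal_CM_module R W \<and> cm_type R W = 1 \<and> finite_inj_dim T R W"


section \<open>Numerical semigroup rings\<close>

definition numerical_semigroup :: "nat set \<Rightarrow> bool" where
  "numerical_semigroup H \<longleftrightarrow> 0 \<in> H \<and> (\<forall>a\<in>H. \<forall>b\<in>H. a + b \<in> H) \<and> finite (UNIV - H)"

definition semigroup_ring :: "nat set \<Rightarrow> ('k::field) fps ring" where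
  "semigroup_ring H = \<lparr>carrier = {f. \<forall>n. fps_nth f n \<noteq> 0 \<longrightarrow> n \<in> H},
                       monoid.mult = (*), one = 1, zero = 0, add = (+)\<rparr>"

lemma semigroup_ring_cring:
  assumes "numerical_semigroup H"
  shows "cring (semigroup_ring H :: ('k::field) fps ring)"
proof -
  have mult: "n \<in> H"
    if "\<forall>n. fps_nth f n \<noteq> 0 \<longrightarrow> n \<in> H" "\<forall>n. fps_nth g n \<noteq> 0 \<longrightarrow> n \<in> H" "fps_nth (f * g) n \<noteq> 0"
    for f g :: "'k fps" and n
  proof -
    from that(3) obtain i where "i \<le> n" "fps_nth f i * fps_nth g (n - i) \<noteq> 0"
      unfolding fps_mult_nth by (meson sum.neutral atLeastAtMost_iff)
    with that(1,2) have "i + (n - i) \<in> H"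
      using assms unfolding numerical_semigroup_def by (metis mult_zero_left mult_zero_right)
    with \<open>i \<le> n\<close> show ?thesis by simp
  qed
  have add: "n \<in> H"
    if "\<forall>n. fps_nth f n \<noteq> 0 \<longrightarrow> n \<in> H" "\<forall>n. fps_nth g n \<noteq> 0 \<longrightarrow> n \<in> H"
      "fps_nth f n + fps_nth g n \<noteq> 0" for f g :: "'k fps" and n
    using that by (cases "fps_nth f n = 0") auto
  show ?thesis
  proof (rule cringI)
    show "abelian_group (semigroup_ring H :: 'k fps ring)"
    proof (rule abelian_groupI)
      fix x :: "'k fps"
      assume "x \<in> carrier (semigroup_ring H)"
      then show "\<exists>y\<in>carrier (semigroup_ring H).
          y \<oplus>\<^bsub>semigroup_ring H\<^esub> x = \<zero>\<^bsub>semigroup_ring H\<^esub>"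
        by (intro bexI[of _ "- x"]) (auto simp: semigroup_ring_def)
    qed (simp_all add: semigroup_ring_def add_ac, metis add)
    show "comm_monoid (semigroup_ring H :: 'k fps ring)"
    proof (rule comm_monoidI)
      show "\<one>\<^bsub>semigroup_ring H\<^esub> \<in> carrier (semigroup_ring H)"
        using assms by (simp add: semigroup_ring_def numerical_semigroup_def)
    qed (simp_all add: semigroup_ring_def mult_ac, metis mult)
  qed (simp add: semigroup_ring_def distrib_right)
qed

text \<open>The fraction field of a subring of the ring of power series, inside the Laurent series.\<close>

definition fraction_field :: "('k::field) fps ring \<Rightarrow> 'k fls set" where
  "fraction_field R =
     {fps_to_fls a / fps_to_fls b | a b. a \<in> carrier R \<and> b \<in> carrier R \<and> b \<noteq> 0}"

text \<open>The conductor \<open>R : K[|t|]\<close>, where \<open>K[|t|]\<close> is the integral closure of \<open>R\<close>.\<close>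

definition conductor :: "('k::field) fps ring \<Rightarrow> 'k fls set" where
  "conductor R =
     {\<alpha> \<in> fraction_field R. \<forall>f :: 'k fps. \<alpha> * fps_to_fls f \<in> fps_to_fls ` carrier R}"

text \<open>Far-flung Gorenstein, for a ring \<open>R\<close> with canonical module \<open>W\<close>.\<close>

definition far_flung_Gorenstein :: "('k::field) fps ring \<Rightarrow> ('k fps, 'b) module \<Rightarrow> bool" where
  "far_flung_Gorenstein R W \<longleftrightarrow> fps_to_fls ` module_trace R W = conductor R"


section \<open>The Rohrbach problem\<close>

text \<open>Only used for finite \<open>A\<close>, so that the least element exists.\<close>

definition rohrbach_n :: "nat set \<Rightarrow> int" where
  "rohrbach_n A = (if 0 \<in> A then int (LEAST n. n \<notin> {a + b | a b. a \<in> A \<and> b \<in> A}) else -1)"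

definition rohrbach_max :: "nat \<Rightarrow> int" where
  "rohrbach_max r = Max {rohrbach_n A | A. finite A \<and> card A = r}"

end

theory Submission
  imports Defs
begin

text \<open>
  Let \<open>c\<close> be the conductor of \<open>H\<close>, let \<open>KK = {z. c - 1 - z \<notin> H}\<close> be the standard canonical ideal
  of \<open>H\<close>, and let \<open>CC\<close> be the \<open>R\<close>-module of the series supported on \<open>KK\<close>.  A finitely generated
  torsion-free module \<open>W\<close> of type 1 with a nonzero map to \<open>R\<close> is isomorphic to \<open>CC\<close>: with
  \<open>y = t^(c+1)\<close>, the socle of \<open>W / y W\<close> is one-dimensional, so each of the \<open>c + 1\<close> steps of a
  filtration of \<open>W / y W\<close>, indexed by \<open>B = H - (y-shift of H)\<close>, has dimension at most 1; a map to
  \<open>R\<close> shows that all the steps are strict, and the right step produces a homomorphism from \<open>CC\<close> to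
  \<open>W\<close> which is injective on the socle modulo \<open>y\<close>, hence an isomorphism by counting and Nakayama.

  Therefore \<open>t^n\<close> lies in the trace of \<open>W\<close> whenever \<open>n + KK \<subseteq> H\<close>.  If the trace is the conductor,
  such \<open>n\<close> are at least \<open>c\<close>, which by duality means \<open>KK + KK = \<nat>\<close>.  Numbers below the multiplicity
  \<open>e\<close> can only be sums of two minimal generators of \<open>KK\<close>; there are at most \<open>r(R)\<close> of these, since
  the generators \<open>z\<close> correspond to the pseudo-Frobenius numbers \<open>c - 1 - z\<close>, which give independent
  socle elements of \<open>R / x R\<close>.
\<close>

section \<open>Lengths of quotients\<close>

text \<open>Chains in \<open>quot_length\<close> increase while filtrations by order decrease: the
  filtration \<open>D\<close> is read from the bottom, keeping one strict step for each index in
  \<open>P\<close>. Steps outside \<open>P\<close> may collapse or not.\<close>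

lemma quot_length_geI:
  fixes D :: "nat \<Rightarrow> 'b set"
  assumes sub: "\<And>s. s \<le> L \<Longrightarrow> submodule (D s) R M \<and> A \<subseteq> D s \<and> D s \<subseteq> B"
    and anti: "\<And>s. s < L \<Longrightarrow> D (Suc s) \<subseteq> D s"
    and strict: "\<And>s. s \<in> P \<Longrightarrow> s < L \<and> D s \<noteq> D (Suc s)"
  shows "enat (card P) \<le> quot_length R M A B"
proof -
  \<comment> \<open>The chain grows downwards with \<open>S\<close>; \<open>c 0 = D S\<close> is
    carried along so that the next term can be placed below it.\<close>
  have "\<exists>c. (\<forall>i < card (P \<inter> {..<S}). c i \<subset> c (Suc i)) \<and>
            (\<forall>i. \<exists>s\<le>S. c i = D s) \<and> c 0 = D S" if "S \<le> L" for S
    using that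
  proof (induction S)
    case 0
    then show ?case by (intro exI[of _ "\<lambda>_. D 0"]) auto
  next
    case (Suc S)
    then obtain c where c: "\<forall>i < card (P \<inter> {..<S}). c i \<subset> c (Suc i)"
      "\<forall>i. \<exists>s\<le>S. c i = D s" "c 0 = D S" by auto
    show ?case
    proof (cases "S \<in> P")
      case True
      have "P \<inter> {..<Suc S} = insert S (P \<inter> {..<S})" using True by (auto simp: less_Suc_eq)
      then have card: "card (P \<inter> {..<Suc S}) = Suc (card (P \<inter> {..<S}))" by simp
      have "D (Suc S) \<subset> D S" using strict[OF True] anti[of S] by auto
      then have "case_nat (D (Suc S)) c i \<subset> case_nat (D (Suc S)) c (Suc i)"
        if "i < card (P \<inter> {..<Suc S})" for i
        using that c card by (cases i) auto
      moreover have "\<exists>s\<le>Suc S. case_nat (D (Suc S)) c i = D s" for i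
        using c(2) by (cases i; simp; metis le_SucI le_refl)
      ultimately show ?thesis by (intro exI[of _ "case_nat (D (Suc S)) c"]) auto
    next
      case False
      \<comment> \<open>For \<open>S\<close> outside \<open>P\<close> the number of steps stays, and
        the bottom term is replaced by the possibly smaller \<open>D (Suc S)\<close>.\<close>
      have eq: "P \<inter> {..<Suc S} = P \<inter> {..<S}" using False by (auto simp: less_Suc_eq)
      have "D (Suc S) \<subseteq> D S" using anti[of S] Suc.prems by auto
      then have "(c(0 := D (Suc S))) i \<subset> (c(0 := D (Suc S))) (Suc i)"
        if "i < card (P \<inter> {..<S})" for i
      proof (cases i)
        case 0
        with that c(1,3) have "D S \<subset> c (Suc 0)" by metis
        then show ?thesis using 0 \<open>D (Suc S) \<subseteq> D S\<close> by auto
      qed (use that c in auto)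
      moreover have "\<exists>s\<le>Suc S. (c(0 := D (Suc S))) i = D s" for i
        using c(2) by (cases i; simp; metis le_SucI le_refl)
      ultimately show ?thesis unfolding eq by (intro exI[of _ "c(0 := D (Suc S))"]) auto
    qed
  qed
  from this[of L] obtain c where c: "\<forall>i < card (P \<inter> {..<L}). c i \<subset> c (Suc i)"
    "\<forall>i. \<exists>s\<le>L. c i = D s" by auto
  have "P \<inter> {..<L} = P" using strict by auto
  moreover have "submodule (c i) R M \<and> A \<subseteq> c i \<and> c i \<subseteq> B" for i
    using c(2) sub by metis
  ultimately show ?thesis
    unfolding quot_length_def using c(1)
    by (intro Sup_upper CollectI exI[of _ "card P"] exI[of _ c] conjI refl) auto
qed

section \<open>The semigroup ring as a one-dimensional local domain\<close>

locale numerical_semigroup_ring =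
  fixes H :: "nat set" and R :: "'k::field fps ring"
  assumes H: "numerical_semigroup H" and R_def: "R = semigroup_ring H"
begin

lemma zero_in_H [simp]: "0 \<in> H" and add_in_H: "a \<in> H \<Longrightarrow> b \<in> H \<Longrightarrow> a + b \<in> H"
  and finite_gaps: "finite (UNIV - H)"
  using H by (auto simp: numerical_semigroup_def)

section \<open>Conductor and least nonzero element of the semigroup\<close>

definition c :: nat where "c = (LEAST c. \<forall>n\<ge>c. n \<in> H)"

lemma ge_c: "n \<ge> c \<Longrightarrow> n \<in> H"
proof -
  obtain k where "\<forall>n\<in>UNIV - H. n < k" using finite_gaps finite_nat_set_iff_bounded by blast
  then have "\<forall>n\<ge>k. n \<in> H" by (metis DiffI UNIV_I leD)
  then have "\<forall>n\<ge>c. n \<in> H" unfolding c_def by (rule LeastI)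
  then show "n \<ge> c \<Longrightarrow> n \<in> H" by blast
qed

text \<open>The Frobenius number \<open>c - 1\<close> is a gap, by minimality of \<open>c\<close>;
  the additive form stays correct for \<open>c = 0\<close>.\<close>

lemma c_pred: "h \<in> H \<Longrightarrow> h + 1 \<noteq> c"
proof
  assume "h \<in> H" "h + 1 = c"
  then have "\<forall>n\<ge>h. n \<in> H" using ge_c by (metis add.commute le_less_Suc_eq not_less plus_1_eq_Suc)
  then have "c \<le> h" unfolding c_def by (rule Least_le)
  then show False using \<open>h + 1 = c\<close> by simp
qed

definition e :: nat where "e = (LEAST h. h \<in> H \<and> h \<noteq> 0)"

lemma e_in_H: "e \<in> H" and e_pos: "e > 0"
proof -
  have "Suc c \<in> H \<and> Suc c \<noteq> 0" using ge_c by simp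
  then have "e \<in> H \<and> e \<noteq> 0" unfolding e_def by (rule LeastI)
  then show "e \<in> H" "e > 0" by auto
qed

lemma e_le: "h \<in> H \<Longrightarrow> h \<noteq> 0 \<Longrightarrow> e \<le> h"
  unfolding e_def by (rule Least_le) simp

section \<open>Membership, units and division in the semigroup ring\<close>

lemma carrier_iff: "f \<in> carrier R \<longleftrightarrow> (\<forall>n. fps_nth f n \<noteq> 0 \<longrightarrow> n \<in> H)"
  and R_mult [simp]: "f \<otimes>\<^bsub>R\<^esub> g = f * g"
  and R_add [simp]: "f \<oplus>\<^bsub>R\<^esub> g = f + g"
  and R_zero [simp]: "\<zero>\<^bsub>R\<^esub> = 0"
  and R_one [simp]: "\<one>\<^bsub>R\<^esub> = 1"
  by (auto simp: R_def semigroup_ring_def)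

sublocale cring R
  unfolding R_def by (rule semigroup_ring_cring[OF H])

lemma in_R:
  "0 \<in> carrier R" "1 \<in> carrier R"
  "f \<in> carrier R \<Longrightarrow> g \<in> carrier R \<Longrightarrow> f * g \<in> carrier R"
  "f \<in> carrier R \<Longrightarrow> g \<in> carrier R \<Longrightarrow> f + g \<in> carrier R"
  "f \<in> carrier R \<Longrightarrow> - f \<in> carrier R"
  "f \<in> carrier R \<Longrightarrow> g \<in> carrier R \<Longrightarrow> f - g \<in> carrier R"
  "fps_const k \<in> carrier R"
  "f \<in> carrier R \<Longrightarrow> f ^ n \<in> carrier R"
proof -
  show "f \<in> carrier R \<Longrightarrow> g \<in> carrier R \<Longrightarrow> f * g \<in> carrier R" for f g
    using m_closed[of f g] by simp
  moreover show "1 \<in> carrier R" using one_closed by simp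
  ultimately show "f \<in> carrier R \<Longrightarrow> f ^ n \<in> carrier R" by (induction n) auto
qed (auto simp: carrier_iff, metis add_0, metis diff_0_right)

lemma R_minus [simp]: "f \<in> carrier R \<Longrightarrow> \<ominus>\<^bsub>R\<^esub> f = - f"
  by (rule minus_equality) (auto simp: in_R)

lemma monom_in_R: "fps_X ^ n \<in> carrier R \<longleftrightarrow> n \<in> H"
  by (auto simp: carrier_iff fps_X_power_nth)

lemma high_in_R: "(\<And>i. i < c \<Longrightarrow> fps_nth f i = 0) \<Longrightarrow> f \<in> carrier R"
  unfolding carrier_iff using ge_c not_less by blast

text \<open>The sets are arbitrary because the supports met later are \<open>H\<close>,
  \<open>KK\<close>, half-lines and shifted semigroups.\<close>

lemma supp_mult:
  assumes "\<And>i. fps_nth f i \<noteq> 0 \<Longrightarrow> i \<in> S" "\<And>i. fps_nth g i \<noteq> 0 \<Longrightarrow> i \<in> T"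
    "fps_nth (f * g :: 'k fps) n \<noteq> 0"
  obtains i j where "i \<in> S" "j \<in> T" "n = i + j"
proof -
  from assms(3) obtain i where "i \<le> n" "fps_nth f i * fps_nth g (n - i) \<noteq> 0"
    unfolding fps_mult_nth by (meson sum.neutral atLeastAtMost_iff)
  then have "i \<in> S" "n - i \<in> T" "n = i + (n - i)" using assms(1,2) by auto
  then show ?thesis using that by blast
qed

text \<open>Each coefficient of the inverse is determined by earlier ones and by coefficients of
  \<open>f\<close>, so its exponents stay in \<open>H\<close> by strong induction. This makes
  \<open>R\<close> local.\<close>

lemma inverse_in_R:
  assumes "f \<in> carrier R" "fps_nth f 0 \<noteq> 0"
  shows "inverse f \<in> carrier R"
proof -
  have "fps_nth (inverse f) n \<noteq> 0 \<Longrightarrow> n \<in> H" for n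
  proof (induction n rule: less_induct)
    case (less n)
    show ?case
    proof (cases n)
      case (Suc m)
      have "fps_nth (inverse f) n = - inverse (fps_nth f 0) *
          (\<Sum>i=1..n. fps_nth f i * fps_nth (inverse f) (n - i))"
        using Suc assms(2) by (simp add: fps_inverse_def)
      then obtain i where i: "i \<in> {1..n}" "fps_nth f i * fps_nth (inverse f) (n - i) \<noteq> 0"
        using less.prems by (metis (no_types, lifting) mult_zero_right sum.neutral)
      then have "i \<in> H" "n - i \<in> H"
        using assms(1) less.IH[of "n - i"] by (auto simp: carrier_iff)
      then show ?thesis using add_in_H[of i "n - i"] i(1) by simp
    qed simp
  qed
  then show ?thesis by (simp add: carrier_iff)
qed

lemma Units_iff: "f \<in> Units R \<longleftrightarrow> f \<in> carrier R \<and> fps_nth f 0 \<noteq> 0"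
proof
  assume "f \<in> Units R"
  then obtain g where "f \<in> carrier R" "f * g = 1" by (auto simp: Units_def)
  moreover from this have "fps_nth f 0 * fps_nth g 0 = 1"
    by (metis fps_mult_nth_0 fps_one_nth)
  ultimately show "f \<in> carrier R \<and> fps_nth f 0 \<noteq> 0" by auto
next
  assume f: "f \<in> carrier R \<and> fps_nth f 0 \<noteq> 0"
  then have "f * inverse f = 1" by (simp add: inverse_mult_eq_1')
  then show "f \<in> Units R" using f inverse_in_R
    unfolding Units_def by (auto intro!: bexI[of _ "inverse f"] simp: mult.commute)
qed

lemma max_ideal_iff: "f \<in> max_ideal R \<longleftrightarrow> f \<in> carrier R \<and> fps_nth f 0 = 0"
  unfolding max_ideal_def by (auto simp: Units_iff)

lemma max_ideal_supp: "f \<in> max_ideal R \<Longrightarrow> fps_nth f n \<noteq> 0 \<Longrightarrow> n \<in> H \<and> n \<noteq> 0 \<and> e \<le> n"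
  using e_le[of n] by (cases "n = 0") (auto simp: max_ideal_iff carrier_iff)

lemma monom_in_max: "h \<in> H \<Longrightarrow> h \<noteq> 0 \<Longrightarrow> fps_X ^ h \<in> max_ideal R"
  by (simp add: max_ideal_iff monom_in_R fps_X_power_nth)

text \<open>The quotient in the power series ring has order at least \<open>c\<close>, so it lies in
  \<open>R\<close>. Hence a nonzero principal ideal contains all series of sufficiently high
  order.\<close>

lemma divide_in_R:
  assumes "a \<noteq> 0" "\<And>i. i < subdegree a + c \<Longrightarrow> fps_nth b i = 0"
  obtains q where "q \<in> carrier R" "b = a * q"
proof (cases "b = 0")
  case True
  then show ?thesis using that[of 0] in_R by auto
next
  case False
  have ge: "subdegree b \<ge> subdegree a + c" using False assms(2) by (intro subdegree_geI) auto
  then have "a dvd b" using subdegree_le_imp_dvd_left_divring[of a b] assms(1) by auto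
  then obtain q where q: "b = a * q" by blast
  then have "subdegree q \<ge> c" using ge False by auto
  then have "q \<in> carrier R" by (intro high_in_R nth_less_subdegree_zero) simp
  then show ?thesis using q that by blast
qed

text \<open>Powers of a non-unit reach any order. This carries the one-dimensionality of
  \<open>R\<close>, and later passes regularity from one element to all nonzero ones.\<close>

lemma power_in_multiples:
  assumes "a \<noteq> 0" "b \<in> max_ideal R"
  obtains q k where "q \<in> carrier R" "k > 0" "b ^ k = a * q"
proof -
  let ?k = "Suc (subdegree a + c)"
  have b0: "fps_nth b 0 = 0" using assms(2) by (simp add: max_ideal_iff)
  have "fps_nth (b ^ ?k) i = 0" if "i < subdegree a + c" for i
  proof -
    have "b \<noteq> 0 \<Longrightarrow> subdegree b > 0"
      using b0 by (metis gr0I nth_subdegree_nonzero)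
    then have "b \<noteq> 0 \<Longrightarrow> ?k \<le> ?k * subdegree b" by (metis One_nat_def Suc_leI mult.right_neutral mult_le_mono2)
    then have "b \<noteq> 0 \<Longrightarrow> ?k \<le> subdegree (b ^ ?k)" by (metis subdegree_power)
    then show ?thesis using that by (cases "b = 0") (auto intro: nth_less_subdegree_zero)
  qed
  then obtain q where "q \<in> carrier R" "b ^ ?k = a * q" using divide_in_R[OF assms(1)] by blast
  then show ?thesis using that by blast
qed

section \<open>Prime ideals and Krull dimension\<close>

lemma additive_subgroupI':
  assumes "S \<subseteq> carrier R" "0 \<in> S" "\<And>f g. f \<in> S \<Longrightarrow> g \<in> S \<Longrightarrow> f + g \<in> S" "\<And>f. f \<in> S \<Longrightarrow> - f \<in> S"
  shows "additive_subgroup S R"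
proof (intro additive_subgroup.intro subgroup.intro)
  fix f assume "f \<in> S"
  then have "\<ominus>\<^bsub>R\<^esub> f \<in> S" using assms by auto
  then show "inv\<^bsub>add_monoid R\<^esub> f \<in> S" by (simp only: a_inv_def)
qed (use assms in auto)

lemma primeideal_max: "primeideal (max_ideal R) R"
proof (rule primeidealI2)
  show "additive_subgroup (max_ideal R) R"
    by (rule additive_subgroupI') (auto simp: max_ideal_iff in_R)
  show "carrier R \<noteq> max_ideal R"
    using in_R(2) by (metis fps_one_nth max_ideal_iff zero_neq_one)
qed (auto simp: max_ideal_iff in_R is_cring)

lemma primeideal_zero: "primeideal {0} R"
proof (rule primeidealI2)
  show "additive_subgroup {0} R"
    by (rule additive_subgroupI') (auto simp: in_R)
  show "carrier R \<noteq> {0}" using in_R(2) by force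
qed (auto simp: in_R is_cring)

text \<open>A nonzero prime contains a power of every non-unit by \<open>power_in_multiples\<close>,
  hence every non-unit.\<close>

lemma primeideal_cases:
  assumes "primeideal P R"
  shows "P = {0} \<or> P = max_ideal R"
proof (rule disjCI)
  assume ne: "P \<noteq> max_ideal R"
  interpret P: primeideal P R by fact
  have sub: "P \<subseteq> max_ideal R"
  proof
    fix f assume f: "f \<in> P"
    have "f \<notin> Units R"
    proof
      assume "f \<in> Units R"
      then have "P = carrier R" using f P.is_ideal by (metis Units_inv_closed Units_l_inv P.I_l_closed P.one_imp_carrier)
      then show False using P.I_notcarr by simp
    qed
    then show "f \<in> max_ideal R" using f P.a_subset by (auto simp: max_ideal_def)
  qed
  show "P = {0}"
  proof (rule ccontr)
    assume "P \<noteq> {0}"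
    then obtain a where a: "a \<in> P" "a \<noteq> 0" using P.zero_closed by force
    have "b \<in> P" if b: "b \<in> max_ideal R" for b
    proof -
      obtain q k where qk: "q \<in> carrier R" "k > 0" "b ^ k = a * q"
        using power_in_multiples[OF a(2) b] by blast
      then have "b ^ k \<in> P" using P.I_r_closed[OF a(1)] by simp
      moreover have bR: "b \<in> carrier R" using b by (simp add: max_ideal_iff)
      have "b ^ j \<in> P \<Longrightarrow> b \<in> P" if "j > 0" for j
        using that
      proof (induction j)
        case (Suc j)
        then show ?case using P.I_prime[OF bR in_R(8)[OF bR, of j]]
          by (cases "j = 0") auto
      qed simp
      ultimately show ?thesis using qk(2) by blast
    qed
    then show False using sub ne by blast
  qed
qed

lemma krull_dim_eq: "krull_dim R = 1"
proof (rule antisym)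
  show "krull_dim R \<le> 1"
    unfolding krull_dim_def
  proof (rule Sup_least, clarify)
    fix n :: nat and P :: "nat \<Rightarrow> 'k fps set"
    assume P: "\<forall>i\<le>n. primeideal (P i) R" "\<forall>i<n. P i \<subset> P (Suc i)"
    have z: "{0} \<subseteq> P i" if "i \<le> n" for i
      using P(1) that primeideal_cases[of "P i"] by (auto simp: max_ideal_iff in_R)
    have "\<not> 2 \<le> n"
    proof
      assume n: "2 \<le> n"
      then have "P 0 \<subset> P 1" "P 1 \<subset> P 2" using P(2) by (auto simp: numeral_2_eq_2)
      then show False
        using z[of 0] z[of 1] n primeideal_cases[of "P 1"] primeideal_cases[of "P 2"] P(1) by auto
    qed
    then show "enat n \<le> 1" by (simp add: one_enat_def)
  qed
  have "{0} \<noteq> max_ideal R"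
    using monom_in_max[OF e_in_H] e_pos by (metis fps_X_power_nth less_not_refl2 singletonD fps_zero_nth zero_neq_one)
  moreover have "{0} \<subseteq> max_ideal R" by (auto simp: max_ideal_iff in_R)
  ultimately have "{0} \<subset> max_ideal R" by blast
  then have "\<forall>i<1. (if i = 0 then {0} else max_ideal R) \<subset> (if Suc i = 0 then {0} else max_ideal R)"
    by simp
  then show "1 \<le> krull_dim R"
    unfolding krull_dim_def one_enat_def using primeideal_max primeideal_zero
    by (intro Sup_upper CollectI exI[of _ 1] exI[of _ "\<lambda>i. if i = 0 then {0} else max_ideal R"] conjI) auto
qed

section \<open>Ideals as submodules and upper bounds for lengths\<close>

lemma ring_module_simps [simp]:
  "carrier (ring_module R) = carrier R" "f \<oplus>\<^bsub>ring_module R\<^esub> g = f + g"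
  "\<zero>\<^bsub>ring_module R\<^esub> = 0" "f \<odot>\<^bsub>ring_module R\<^esub> g = f * g"
  by (simp_all add: ring_module_def)

lemma module_ring_module: "Module.module R (ring_module R)"
  by (rule ring_module_is_module) (rule is_cring)

lemma submodule_ring_module_iff:
  "submodule N R (ring_module R) \<longleftrightarrow>
     N \<subseteq> carrier R \<and> 0 \<in> N \<and> (\<forall>f\<in>N. \<forall>g\<in>N. f + g \<in> N) \<and> (\<forall>a\<in>carrier R. \<forall>f\<in>N. a * f \<in> N)"
  (is "_ \<longleftrightarrow> ?rhs")
proof
  interpret M: Module.module R "ring_module R" by (rule module_ring_module)
  show "submodule N R (ring_module R) \<Longrightarrow> ?rhs"
    using M.submoduleE[of N] submodule.axioms(1)[of N R "ring_module R"] subgroup.one_closed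
    by fastforce
  assume N: ?rhs
  have "- f \<in> N" if "f \<in> N" for f
    using N that in_R(5)[OF in_R(2)] by (metis mult_minus1)
  moreover have "\<ominus>\<^bsub>ring_module R\<^esub> f = - f" if "f \<in> N" for f
    using that N by (intro M.minus_equality) (auto simp: in_R)
  ultimately show "submodule N R (ring_module R)"
    using N by (intro M.submoduleI) auto
qed

text \<open>Gaussian elimination by order: an element of \<open>D' - D\<close> of maximal order
  cannot share its order with an element of \<open>D\<close>, since cancelling leading terms would
  give one of higher order. The maximum exists because \<open>high\<close> bounds these orders by
  \<open>L\<close>.\<close>

lemma subdegrees_strict_mono:
  fixes D D' :: "'k fps set"
  assumes psub: "D \<subset> D'"
    and D: "\<And>f g. f \<in> D \<Longrightarrow> g \<in> D \<Longrightarrow> f + g \<in> D" "\<And>f k. f \<in> D \<Longrightarrow> fps_const k * f \<in> D"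
    and D': "\<And>f g. f \<in> D' \<Longrightarrow> g \<in> D' \<Longrightarrow> f + g \<in> D'" "\<And>f k. f \<in> D' \<Longrightarrow> fps_const k * f \<in> D'"
    and high: "\<And>f. f \<in> D' \<Longrightarrow> (\<And>i. i < L \<Longrightarrow> fps_nth f i = 0) \<Longrightarrow> f \<in> D"
    and ne: "D \<noteq> {}"
  shows "{subdegree f | f. f \<in> D \<and> f \<noteq> 0 \<and> subdegree f < L}
       \<subset> {subdegree f | f. f \<in> D' \<and> f \<noteq> 0 \<and> subdegree f < L}" (is "?V D \<subset> ?V D'")
proof -
  have zero: "0 \<in> D" using ne D(2)[of _ 0] by auto
  have small: "d \<noteq> 0 \<and> subdegree d < L" if "d \<in> D' - D" for d
  proof -
    have "\<not> L \<le> subdegree d"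
      using high[of d] that nth_less_subdegree_zero[of _ d] by (meson DiffE order_less_le_trans)
    then show ?thesis using that zero by auto
  qed
  obtain d where d: "d \<in> D' - D" and max: "\<And>d'. d' \<in> D' - D \<Longrightarrow> subdegree d' \<le> subdegree d"
    using psub ex_has_greatest_nat[of "\<lambda>d. d \<in> D' - D" _ subdegree L] small
    by (metis less_imp_le_nat psubset_imp_ex_mem)
  have "subdegree d \<notin> ?V D"
  proof
    assume "subdegree d \<in> ?V D"
    then obtain d0 where d0: "d0 \<in> D" "d0 \<noteq> 0" "subdegree d0 = subdegree d" by auto
    define k where "k = - (fps_nth d (subdegree d) / fps_nth d0 (subdegree d))"
    define d1 where "d1 = d + fps_const k * d0"
    have nz: "fps_nth d0 (subdegree d) \<noteq> 0" using d0 by (metis nth_subdegree_nonzero)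
    have "fps_nth d1 i = 0" if "i \<le> subdegree d" for i
    proof (cases "i = subdegree d")
      case True
      then show ?thesis using nz by (simp add: d1_def k_def)
    next
      case False
      then have "i < subdegree d" "i < subdegree d0" using that d0 by auto
      then have "fps_nth d i = 0" "fps_nth d0 i = 0" by blast+
      then show ?thesis by (simp add: d1_def)
    qed
    moreover have "d1 \<in> D' - D"
    proof
      have "d \<in> D'" "d0 \<in> D'" using d d0(1) psubset_imp_subset[OF psub] by blast+
      then show "d1 \<in> D'" unfolding d1_def by (intro D')
      show "d1 \<notin> D"
      proof
        assume "d1 \<in> D"
        then have "d1 + fps_const (- k) * d0 \<in> D" by (intro D d0(1))
        moreover have "fps_const k * d0 + fps_const (- k) * d0 = 0"
          by (metis distrib_right fps_const_add fps_const_0_eq_0 add.right_inverse mult_zero_left)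
        then have "d1 + fps_const (- k) * d0 = d" by (simp add: d1_def add.assoc)
        ultimately show False using d by simp
      qed
    qed
    ultimately show False using max[of d1] small[of d1] by (metis nth_subdegree_nonzero)
  qed
  moreover have "subdegree d \<in> ?V D'" using d small[OF d] by auto
  moreover have "?V D \<subseteq> ?V D'" using psub by auto
  ultimately show ?thesis by blast
qed

text \<open>A strict chain of submodules yields a strict chain of subsets of \<open>{..<L}\<close>,
  the sets of orders, so it has at most \<open>L\<close> steps.\<close>

lemma quot_length_le:
  assumes A: "\<And>f. f \<in> carrier R \<Longrightarrow> (\<And>i. i < L \<Longrightarrow> fps_nth f i = 0) \<Longrightarrow> f \<in> A"
  shows "quot_length R (ring_module R) A B \<le> enat L"
  unfolding quot_length_def
proof (rule Sup_least, clarify)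
  fix n :: nat and c :: "nat \<Rightarrow> 'k fps set"
  assume c: "\<forall>i\<le>n. submodule (c i) R (ring_module R) \<and> A \<subseteq> c i \<and> c i \<subseteq> B"
    "\<forall>i<n. c i \<subset> c (Suc i)"
  define V where "V i = {subdegree f | f. f \<in> c i \<and> f \<noteq> 0 \<and> subdegree f < L}" for i
  have fin: "finite (V i)" "V i \<subseteq> {..<L}" for i
    using finite_subset[of "V i" "{..<L}"] unfolding V_def by auto
  have "i \<le> card (V i)" if "i \<le> n" for i
    using that
  proof (induction i)
    case (Suc i)
    then have N: "submodule (c i) R (ring_module R)" "submodule (c (Suc i)) R (ring_module R)"
      "A \<subseteq> c i" "c i \<subset> c (Suc i)"
      using c by auto
    have "V i \<subset> V (Suc i)"
      unfolding V_def
    proof (rule subdegrees_strict_mono[OF N(4)])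
      fix f assume "f \<in> c (Suc i)" "\<And>i. i < L \<Longrightarrow> fps_nth f i = 0"
      then show "f \<in> c i" using N(2,3) A[of f] by (auto simp: submodule_ring_module_iff)
    qed (use N(1,2) in_R(7) in \<open>auto simp: submodule_ring_module_iff\<close>)
    then show ?case using Suc psubset_card_mono[OF fin(1)] by (meson Suc_leD Suc_leI le_less_trans)
  qed simp
  then have "n \<le> card (V n)" by simp
  also have "\<dots> \<le> L" using card_mono[OF _ fin(2)] by simp
  finally show "enat n \<le> enat L" by simp
qed

subsection \<open>Multiplicity\<close>

text \<open>Non-units have order at least \<open>e\<close>, and orders add. With
  \<open>ideal_power_high\<close> this locates the powers of the maximal ideal up to the constant
  \<open>c\<close>.\<close>

lemma ideal_power_low: "f \<in> ideal_power R (max_ideal R) n \<Longrightarrow> f \<in> carrier R \<and> (\<forall>i<n * e. fps_nth f i = 0)"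
proof (induction n arbitrary: f)
  case (Suc n)
  from Suc.prems have "f \<in> ideal_prod R (max_ideal R) (ideal_power R (max_ideal R) n)" by simp
  then show ?case
  proof induction
    case (prod a g)
    have "fps_nth (a * g) k = 0" if "k < Suc n * e" for k
    proof (rule ccontr)
      assume nz: "fps_nth (a * g) k \<noteq> 0"
      have "fps_nth g i \<noteq> 0 \<Longrightarrow> n * e \<le> i" for i using Suc.IH[OF prod(2)] not_less by blast
      then obtain i j where "e \<le> i" "n * e \<le> j" "k = i + j"
        using supp_mult[of a "{e..}" g "{n*e..}" k, OF _ _ nz] max_ideal_supp[OF prod(1)] by auto
      then show False using that by simp
    qed
    then show ?case using prod Suc.IH[OF prod(2)] by (auto simp: max_ideal_iff in_R)
  qed (auto simp: in_R)
qed simp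

text \<open>A factor \<open>fps_X ^ e\<close> can be split off \<open>n\<close> times; the surplus
  \<open>c\<close> guarantees that what remains lies in \<open>R\<close>.\<close>

lemma ideal_power_high: "(\<And>i. i < n * e + c \<Longrightarrow> fps_nth f i = 0) \<Longrightarrow> f \<in> ideal_power R (max_ideal R) n"
proof (induction n arbitrary: f)
  case 0
  then show ?case using high_in_R by simp
next
  case (Suc n)
  have "f = fps_X ^ e * fps_shift e f"
    using Suc.prems by (intro fps_ext) (auto simp: fps_X_power_mult_nth)
  moreover have "fps_shift e f \<in> ideal_power R (max_ideal R) n"
    using Suc.prems by (intro Suc.IH) simp
  ultimately show ?case
    using ideal_prod.prod[OF monom_in_max[OF e_in_H], of "fps_shift e f" _ R] e_pos by simp
qed

text \<open>The length of \<open>R\<close> modulo the \<open>n\<close>-th power of the maximal ideal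
  differs from \<open>n * e\<close> by at most \<open>c\<close>, and the dimension is 1, so the
  normalized limit is \<open>e\<close>.\<close>

lemma multiplicity_eq: "multiplicity_of_ring R = real e"
proof -
  define l where "l n = quot_length R (ring_module R) (ideal_power R (max_ideal R) n) (carrier R)" for n
  have up: "l n \<le> enat (n * e + c)" for n
    unfolding l_def by (rule quot_length_le) (rule ideal_power_high)
  have low: "enat (n * e - c) \<le> l n" for n
  proof -
    \<comment> \<open>The order filtration of \<open>R\<close> drops at each element of
      \<open>H\<close> below \<open>n * e\<close>, and at most \<open>c\<close> numbers in that
      range are gaps.\<close>
    define D where "D s = {f \<in> carrier R. \<forall>i<s. fps_nth f i = 0}" for s
    have "enat (card (H \<inter> {..<n * e})) \<le> l n"
      unfolding l_def
    proof (rule quot_length_geI[where D = D and L = "n * e"])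
      fix s assume s: "s \<le> n * e"
      have "fps_nth (a * f) i = 0" if "\<forall>i<s. fps_nth f i = 0" "i < s" for a f :: "'k fps" and i
      proof (rule ccontr)
        assume nz: "fps_nth (a * f) i \<noteq> 0"
        have "fps_nth f i \<noteq> 0 \<Longrightarrow> s \<le> i" for i using that(1) not_less by blast
        then obtain p q where "s \<le> q" "i = p + q"
          by (rule supp_mult[of a UNIV f "{s..}" i, OF _ _ nz, simplified])
        then show False using that(2) by simp
      qed
      then have "submodule (D s) R (ring_module R)"
        unfolding submodule_ring_module_iff D_def by (auto simp: in_R)
      then show "submodule (D s) R (ring_module R) \<and> ideal_power R (max_ideal R) n \<subseteq> D s \<and> D s \<subseteq> carrier R"
        using ideal_power_low s unfolding D_def by fastforce
    next
      fix s assume "s \<in> H \<inter> {..<n * e}"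
      then have "fps_X ^ s \<in> D s" "fps_X ^ s \<notin> D (Suc s)" "s < n * e"
        by (auto simp: D_def monom_in_R fps_X_power_nth)
      then show "s < n * e \<and> D s \<noteq> D (Suc s)" by blast
    qed (auto simp: D_def)
    moreover have "card {c..<n * e} \<le> card (H \<inter> {..<n * e})"
      using ge_c by (intro card_mono) auto
    ultimately show ?thesis by (cases "l n") auto
  qed
  define q where "q n = real (the_enat (l n))" for n
  have q: "real n * real e - real c \<le> q n" "q n \<le> real n * real e + real c" for n
  proof -
    \<comment> \<open>The upper bound makes the length finite, so \<open>the_enat\<close> returns
      its true value.\<close>
    obtain k where k: "l n = enat k" "k \<le> n * e + c" using up[of n] by (metis enat_ile enat_ord_simps(1))
    with low[of n] have "n * e \<le> k + c" by auto
    with k(2) have "real (n * e) \<le> real (k + c)" "real k \<le> real (n * e + c)" by linarith+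
    then show "real n * real e - real c \<le> q n" "q n \<le> real n * real e + real c"
      by (simp_all add: q_def k)
  qed
  have "(\<lambda>n. q n / real n) \<longlonglongrightarrow> real e"
  proof (rule tendsto_sandwich)
    show "\<forall>\<^sub>F n in sequentially. real e - real c / real n \<le> q n / real n"
      using eventually_gt_at_top[of 0]
    proof eventually_elim
      case (elim n)
      then have "real e - real c / real n = (real n * real e - real c) / real n"
        by (simp add: field_simps)
      then show ?case using q(1)[of n] by (simp add: divide_right_mono)
    qed
    show "\<forall>\<^sub>F n in sequentially. q n / real n \<le> real e + real c / real n"
      using eventually_gt_at_top[of 0]
    proof eventually_elim
      case (elim n)
      then show ?case using q(2)[of n] by (simp add: field_simps)
    qed
    show "(\<lambda>n. real e - real c / real n) \<longlonglongrightarrow> real e"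
      using tendsto_diff[OF tendsto_const lim_const_over_n[of "real c"]] by simp
    show "(\<lambda>n. real e + real c / real n) \<longlonglongrightarrow> real e"
      using tendsto_add[OF tendsto_const lim_const_over_n[of "real c"]] by simp
  qed
  then have "lim (\<lambda>n. q n / real n) = real e" by (rule limI)
  then show ?thesis
    by (simp add: multiplicity_of_ring_def krull_dim_eq one_enat_def q_def l_def)
qed

end

section \<open>Modules\<close>

text \<open>The constants of \<open>Defs\<close> need a ring without record extension.\<close>

locale plain_module = Module.module R M
  for R :: "'a ring" (structure) and M :: "('a, 'b) module" (structure)

lemma (in plain_module) seq_mult_Nil: "seq_mult R M [] = {\<zero>\<^bsub>M\<^esub>}"
proof -
  have "submodule {\<zero>\<^bsub>M\<^esub>} R M" by (rule submoduleI) auto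
  moreover have "\<zero>\<^bsub>M\<^esub> \<in> N" if "submodule N R M" for N
    using submodule.axioms(1)[OF that] subgroup.one_closed by fastforce
  ultimately show ?thesis unfolding seq_mult_def submodule_span_def by auto
qed

lemma (in plain_module) submodule_smult_image:
  assumes "x \<in> carrier R"
  shows "submodule ((\<lambda>v. x \<odot>\<^bsub>M\<^esub> v) ` carrier M) R M"
proof (rule submoduleI)
  show "\<zero>\<^bsub>M\<^esub> \<in> (\<lambda>v. x \<odot>\<^bsub>M\<^esub> v) ` carrier M" using assms by (intro image_eqI[of _ _ "\<zero>\<^bsub>M\<^esub>"]) auto
next
  fix a b assume "a \<in> (\<lambda>v. x \<odot>\<^bsub>M\<^esub> v) ` carrier M" "b \<in> (\<lambda>v. x \<odot>\<^bsub>M\<^esub> v) ` carrier M"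
  then obtain v w where "v \<in> carrier M" "w \<in> carrier M" "a = x \<odot>\<^bsub>M\<^esub> v" "b = x \<odot>\<^bsub>M\<^esub> w" by auto
  then show "a \<oplus>\<^bsub>M\<^esub> b \<in> (\<lambda>v. x \<odot>\<^bsub>M\<^esub> v) ` carrier M"
    using assms by (intro image_eqI[of _ _ "v \<oplus>\<^bsub>M\<^esub> w"]) (auto simp: smult_r_distr)
next
  fix a assume "a \<in> (\<lambda>v. x \<odot>\<^bsub>M\<^esub> v) ` carrier M"
  then obtain v where "v \<in> carrier M" "a = x \<odot>\<^bsub>M\<^esub> v" by auto
  then show "\<ominus>\<^bsub>M\<^esub> a \<in> (\<lambda>v. x \<odot>\<^bsub>M\<^esub> v) ` carrier M"
    using assms by (intro image_eqI[of _ _ "\<ominus>\<^bsub>M\<^esub> v"]) (auto simp: smult_r_minus)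
next
  fix a b assume a: "a \<in> carrier R" and "b \<in> (\<lambda>v. x \<odot>\<^bsub>M\<^esub> v) ` carrier M"
  then obtain v where "v \<in> carrier M" "b = x \<odot>\<^bsub>M\<^esub> v" by auto
  then show "a \<odot>\<^bsub>M\<^esub> b \<in> (\<lambda>v. x \<odot>\<^bsub>M\<^esub> v) ` carrier M"
    using assms a by (intro image_eqI[of _ _ "a \<odot>\<^bsub>M\<^esub> v"]) (auto simp: R.m_comm simp flip: smult_assoc1)
qed (use assms in auto)

text \<open>The multiples of a single element already form a submodule, so the span adds
  nothing.\<close>

lemma (in plain_module) seq_mult_single:
  assumes "x \<in> carrier R"
  shows "seq_mult R M [x] = (\<lambda>v. x \<odot>\<^bsub>M\<^esub> v) ` carrier M"
proof -
  have "{a \<odot>\<^bsub>M\<^esub> v | a v. a \<in> set [x] \<and> v \<in> carrier M} = (\<lambda>v. x \<odot>\<^bsub>M\<^esub> v) ` carrier M" by auto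
  then show ?thesis
    unfolding seq_mult_def submodule_span_def using submodule_smult_image[OF assms] by auto
qed

section \<open>The Rohrbach problem and the type of the ring\<close>

text \<open>This extracts an actual regular sequence of length 1 from the statement that the depth
  is 1.\<close>

lemma enat_Sup_eq_1:
  fixes X :: "enat set"
  assumes "Sup X = 1"
  shows "1 \<in> X"
proof -
  have le: "\<And>x. x \<in> X \<Longrightarrow> x \<le> 1" using assms Sup_upper by fastforce
  have "\<exists>x\<in>X. x \<noteq> 0"
  proof (rule ccontr)
    assume "\<not> (\<exists>x\<in>X. x \<noteq> 0)"
    then have "Sup X \<le> 0" by (intro Sup_least) auto
    then show False using assms by simp
  qed
  then obtain x where "x \<in> X" "x \<noteq> 0" by blast
  moreover from this have "x = 1" using le by (metis antisym ileI1 one_eSuc zero_less_iff_neq_zero)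
  ultimately show ?thesis by simp
qed

text \<open>All numbers below the first non-sum are sums, and \<open>r\<close> elements have at most
  \<open>r * r\<close> sums. The bounds make the set under \<open>Max\<close> finite.\<close>

lemma rohrbach_n_bounds:
  assumes "finite A" "card A = r"
  shows "- 1 \<le> rohrbach_n A" "rohrbach_n A \<le> int (r * r)"
proof -
  let ?S = "{a + b | a b. a \<in> A \<and> b \<in> A}"
  let ?n = "LEAST n. n \<notin> ?S"
  have S: "?S = (\<lambda>(a, b). a + b) ` (A \<times> A)" by auto
  have "{..<?n} \<subseteq> ?S" using not_less_Least by (metis (no_types, lifting) lessThan_iff subsetI)
  then have "card {..<?n} \<le> card ?S" unfolding S using assms by (intro card_mono) auto
  also have "\<dots> \<le> r * r"
    unfolding S using card_image_le[of "A \<times> A" "\<lambda>(a, b). a + b"] assms by (simp add: card_cartesian_product)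
  finally have "?n \<le> r * r" by simp
  then have "int ?n \<le> int (r * r)" by linarith
  then show "- 1 \<le> rohrbach_n A" "rohrbach_n A \<le> int (r * r)"
    unfolding rohrbach_n_def by (auto simp del: of_nat_mult)
qed

text \<open>Padding \<open>A\<close> to exactly \<open>r\<close> elements keeps its sums. As
  \<open>k > 0\<close>, the number 0 is a sum, which puts 0 in the set and rules out the value
  -1.\<close>

lemma le_rohrbach_max:
  assumes A: "finite A" "card A \<le> r" and sums: "\<And>n. n < k \<Longrightarrow> n \<in> {a + b | a b. a \<in> A \<and> b \<in> A}"
    and "k > 0"
  shows "int k \<le> rohrbach_max r"
proof -
  obtain C where C: "finite C" "C \<inter> A = {}" "card C = r - card A"
    using infinite_arbitrarily_large[of "UNIV - A" "r - card A"] A(1) by (auto simp: infinite_UNIV_nat)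
  define B where "B = A \<union> C"
  have B: "finite B" "card B = r" "A \<subseteq> B"
    using A C by (auto simp: B_def card_Un_disjoint Int_commute)
  let ?S = "{a + b | a b. a \<in> B \<and> b \<in> B}"
  have "?S = (\<lambda>(a, b). a + b) ` (B \<times> B)" by auto
  then have "finite ?S" using B(1) by simp
  \<comment> \<open>A finite sum-set misses some number, so \<open>LEAST\<close> denotes an actual
    non-sum.\<close>
  then have "\<exists>n. n \<notin> ?S" using ex_new_if_finite infinite_UNIV_nat by blast
  then have "(LEAST n. n \<notin> ?S) \<notin> ?S" by (rule LeastI_ex)
  moreover have "{a + b | a b. a \<in> A \<and> b \<in> A} \<subseteq> ?S" using B(3) by blast
  ultimately have "(LEAST n. n \<notin> ?S) \<notin> {a + b | a b. a \<in> A \<and> b \<in> A}" by (meson subsetD)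
  then have "\<not> (LEAST n. n \<notin> ?S) < k" by (rule contrapos_nn) (rule sums)
  then have "k \<le> (LEAST n. n \<notin> ?S)" by (rule leI)
  moreover have "0 \<in> B" using sums[OF \<open>k > 0\<close>] B(3) by auto
  ultimately have "int k \<le> rohrbach_n B" by (simp add: rohrbach_n_def)
  also have "\<dots> \<le> rohrbach_max r"
    unfolding rohrbach_max_def
  proof (rule Max_ge)
    have "{rohrbach_n A | A. finite A \<and> card A = r} \<subseteq> {- 1..int (r * r)}"
      using rohrbach_n_bounds by auto
    then show "finite {rohrbach_n A | A. finite A \<and> card A = r}" by (rule finite_subset) simp
  qed (use B in auto)
  finally show ?thesis .
qed

section \<open>The canonical ideal of the semigroup, its generators, and duality\<close>

context numerical_semigroup_ring
begin

text \<open>The equation avoids the truncated subtraction in \<open>c - 1 - z\<close> and covers \<open>c = 0\<close>, where \<open>KK = \<nat>\<close>.\<close>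

definition KK :: "nat set" where "KK = {z. \<forall>h\<in>H. h + z + 1 \<noteq> c}"

text \<open>The minimal generators of \<open>KK\<close> over \<open>H\<close>; the guard
  \<open>m \<le> z\<close> keeps the subtraction exact.\<close>

definition gens :: "nat set" where "gens = {z \<in> KK. \<forall>m\<in>H. m \<noteq> 0 \<longrightarrow> m \<le> z \<longrightarrow> z - m \<notin> KK}"

lemma zero_in_KK: "0 \<in> KK"
  using c_pred by (simp add: KK_def)

lemma ge_c_in_KK: "z \<ge> c \<Longrightarrow> z \<in> KK"
  by (auto simp: KK_def)

lemma KK_add: "h \<in> H \<Longrightarrow> k \<in> KK \<Longrightarrow> h + k \<in> KK"
  unfolding KK_def using add_in_H[of _ h] by (fastforce simp: ac_simps)

lemma notin_KK: "z \<notin> KK \<longleftrightarrow> z < c \<and> c - 1 - z \<in> H"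
proof
  assume "z \<notin> KK"
  then obtain h where "h \<in> H" "h + z + 1 = c" by (auto simp: KK_def)
  moreover from this have "h = c - 1 - z" by simp
  ultimately show "z < c \<and> c - 1 - z \<in> H" by auto
next
  assume "z < c \<and> c - 1 - z \<in> H"
  then show "z \<notin> KK" unfolding KK_def by (auto intro!: bexI[of _ "c - 1 - z"])
qed

text \<open>An element \<open>z > c\<close> lies in \<open>H\<close> and is \<open>z + 0\<close>
  with 0 in \<open>KK\<close>, so it is not minimal.\<close>

lemma gens_le: "z \<in> gens \<Longrightarrow> z \<le> c"
proof (rule ccontr)
  assume z: "z \<in> gens" "\<not> z \<le> c"
  then have "z \<in> H" "z \<noteq> 0" using ge_c by auto
  then have "z - z \<notin> KK" using z(1) by (auto simp: gens_def)
  then show False using zero_in_KK by simp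
qed

lemma finite_gens: "finite gens"
  using gens_le finite_subset[of gens "{..c}"] by auto

text \<open>Duality turns minimality of \<open>z\<close> into the statement that
  \<open>c - 1 - z\<close> is pseudo-Frobenius. The 1 is subtracted last to cover
  \<open>c = 0\<close>, where that number is -1.\<close>

lemma gens_dual:
  assumes "z \<in> gens" "m \<in> H" "m \<noteq> 0"
  shows "c - z + m - 1 \<in> H"
proof (cases "m \<le> z")
  case True
  then have "z - m \<notin> KK" using assms by (auto simp: gens_def)
  then have "z - m < c" "c - 1 - (z - m) \<in> H" using notin_KK by auto
  moreover have "c - 1 - (z - m) = c - z + m - 1" using True gens_le[OF assms(1)] assms(3) \<open>z - m < c\<close> by linarith
  ultimately show ?thesis by simp
next
  case False
  then show ?thesis using gens_le[OF assms(1)] by (intro ge_c) linarith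
qed

text \<open>Elements outside \<open>x R\<close> have bounded order. One of maximal order works,
  since multiplication by a non-unit raises the order.\<close>

lemma socle_element:
  assumes "x \<in> max_ideal R" "x \<noteq> 0"
  obtains v where "v \<in> carrier R" "v \<notin> (*) x ` carrier R" "\<And>a. a \<in> max_ideal R \<Longrightarrow> a * v \<in> (*) x ` carrier R"
proof -
  define N where "N = (*) x ` carrier R"
  have high: "f \<in> N" if "f = 0 \<or> subdegree x + c \<le> subdegree f" for f
  proof -
    have "fps_nth f i = 0" if "i < subdegree x + c" for i
      using that \<open>f = 0 \<or> subdegree x + c \<le> subdegree f\<close> by (metis fps_zero_nth nth_less_subdegree_zero order_less_le_trans)
    then obtain q where "q \<in> carrier R" "f = x * q" using divide_in_R[OF assms(2)] by blast
    then show ?thesis by (auto simp: N_def)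
  qed
  have "1 \<notin> N"
    unfolding N_def using assms(1) by (auto simp: max_ideal_iff) (metis fps_mult_nth_0 fps_one_nth mult_zero_left zero_neq_one)
  then have one: "1 \<in> carrier R - N" using in_R by simp
  have bound: "\<forall>y. y \<in> carrier R - N \<longrightarrow> subdegree y < subdegree x + c"
    using high by (metis DiffD2 not_le)
  obtain v where v: "v \<in> carrier R - N" "\<forall>y. y \<in> carrier R - N \<longrightarrow> subdegree y \<le> subdegree v"
    using ex_has_greatest_nat[of "\<lambda>v. v \<in> carrier R - N", OF one bound] by (elim exE conjE)
  have "a * v \<in> N" if a: "a \<in> max_ideal R" for a
  proof (rule ccontr)
    assume n: "a * v \<notin> N"
    then have nz: "a \<noteq> 0" "v \<noteq> 0" using high[of 0] by auto
    have "a * v \<in> carrier R - N" using n a v(1) in_R(3)[of a v] by (auto simp: max_ideal_iff)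
    then have "subdegree (a * v) \<le> subdegree v" using v(2) by simp
    then have "subdegree a = 0" using nz by simp
    then show False using a nz by (simp add: max_ideal_iff subdegree_eq_0_iff)
  qed
  then show ?thesis using v(1) that by (auto simp: N_def)
qed

section \<open>Regular sequences, depth and type of the ring\<close>

lemma plain_module_ring: "plain_module R (ring_module R)"
  unfolding plain_module_def by (rule module_ring_module)

lemma seq_mult_ring:
  "seq_mult R (ring_module R) [] = {0}"
  "x \<in> carrier R \<Longrightarrow> seq_mult R (ring_module R) [x] = (*) x ` carrier R"
proof -
  show "seq_mult R (ring_module R) [] = {0}"
    using plain_module.seq_mult_Nil[OF plain_module_ring] by simp
  assume "x \<in> carrier R"
  then show "seq_mult R (ring_module R) [x] = (*) x ` carrier R"
    using plain_module.seq_mult_single[OF plain_module_ring, of x] by (simp add: image_def)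
qed

lemma regular_seq_ring_single:
  "regular_seq R (ring_module R) [x] \<longleftrightarrow> x \<in> max_ideal R \<and> x \<noteq> 0"
proof
  assume *: "regular_seq R (ring_module R) [x]"
  then have "x * 1 \<in> {0} \<longrightarrow> (1 :: 'k fps) \<in> {0}"
    using in_R(2) unfolding regular_seq_def by (auto simp: seq_mult_ring)
  then show "x \<in> max_ideal R \<and> x \<noteq> 0" using * by (auto simp: regular_seq_def)
next
  assume x: "x \<in> max_ideal R \<and> x \<noteq> 0"
  then have "(*) x ` carrier R \<noteq> carrier R" using socle_element by metis
  then show "regular_seq R (ring_module R) [x]"
    using x unfolding regular_seq_def by (auto simp: seq_mult_ring max_ideal_iff)
qed

text \<open>A nonzero socle element modulo the first entry is killed by the second, contrary to
  regularity.\<close>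

lemma regular_seq_ring_length: "regular_seq R (ring_module R) xs \<Longrightarrow> length xs \<le> 1"
proof (rule ccontr)
  assume *: "regular_seq R (ring_module R) xs" "\<not> length xs \<le> 1"
  then obtain x y zs where xs: "xs = x # y # zs" by (cases xs; cases "tl xs") auto
  have mem: "x \<in> max_ideal R" "y \<in> max_ideal R"
    and reg: "\<And>i v. i < length xs \<Longrightarrow> v \<in> carrier R \<Longrightarrow> xs ! i * v \<in> seq_mult R (ring_module R) (take i xs)
       \<Longrightarrow> v \<in> seq_mult R (ring_module R) (take i xs)"
    using * by (auto simp: regular_seq_def xs)
  have "x \<noteq> 0" using reg[of 0 1] in_R(2) by (auto simp: xs seq_mult_ring)
  then obtain v where v: "v \<in> carrier R" "v \<notin> (*) x ` carrier R" "\<And>a. a \<in> max_ideal R \<Longrightarrow> a * v \<in> (*) x ` carrier R"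
    using socle_element mem(1) by metis
  show False
    using reg[of 1 v] v mem by (auto simp: xs seq_mult_ring max_ideal_iff)
qed

lemma depth_ring: "module_depth R (ring_module R) = 1"
proof (rule antisym)
  show "module_depth R (ring_module R) \<le> 1"
    unfolding module_depth_def using regular_seq_ring_length
    by (intro Sup_least) (auto simp: one_enat_def)
  have "fps_X ^ e \<noteq> (0 :: 'k fps)" by simp
  then have "regular_seq R (ring_module R) [fps_X ^ e]"
    unfolding regular_seq_ring_single using monom_in_max e_in_H e_pos by simp
  then show "1 \<le> module_depth R (ring_module R)"
    unfolding module_depth_def one_enat_def by (intro Sup_upper CollectI exI[of _ "[fps_X ^ e]"]) auto
qed

text \<open>With \<open>x = t x'\<close>, the socle elements \<open>x t^(c - 1 - z)\<close> for \<open>z \<in> gens\<close> are written as \<open>x' t^(c - z)\<close>, since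
  \<open>c - 1 - z\<close> is \<open>-1\<close> when \<open>H = \<nat>\<close>.\<close>

lemma type_ring_bounds:
  shows "enat (card gens) \<le> cm_type R (ring_module R)" "cm_type R (ring_module R) \<noteq> \<infinity>"
proof -
  \<comment> \<open>\<open>cm_type\<close> leaves the regular sequence to choice; it is known to be
    a single nonzero non-unit \<open>x\<close>, so the argument has to fit every such
    \<open>x\<close>.\<close>
  define xs where "xs = (SOME xs. regular_seq R (ring_module R) xs \<and> enat (length xs) = module_depth R (ring_module R))"
  have "fps_X ^ e \<noteq> (0 :: 'k fps)" by simp
  then have "regular_seq R (ring_module R) [fps_X ^ e]"
    unfolding regular_seq_ring_single using monom_in_max e_in_H e_pos by simp
  then have "regular_seq R (ring_module R) xs \<and> enat (length xs) = module_depth R (ring_module R)"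
    unfolding xs_def by (rule_tac someI[of _ "[fps_X ^ e]"]) (simp add: depth_ring one_enat_def)
  then have xs: "regular_seq R (ring_module R) xs" "length xs = 1"
    by (auto simp: depth_ring one_enat_def)
  then obtain x where x1: "xs = [x]" by (cases xs) auto
  then have x: "x \<in> max_ideal R" "x \<noteq> 0" "x \<in> carrier R"
    using xs(1) by (auto simp: regular_seq_ring_single max_ideal_iff)
  let ?S = "{v \<in> carrier R. \<forall>a\<in>max_ideal R. a * v \<in> (*) x ` carrier R}"
  have type: "cm_type R (ring_module R) = quot_length R (ring_module R) ((*) x ` carrier R) ?S"
    unfolding cm_type_def Let_def xs_def[symmetric] x1 using x(3) by (simp add: seq_mult_ring)
  have "quot_length R (ring_module R) ((*) x ` carrier R) ?S \<le> enat (subdegree x + c)"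
  proof (rule quot_length_le)
    fix f :: "'k fps" assume "\<And>i. i < subdegree x + c \<Longrightarrow> fps_nth f i = 0"
    then obtain q where "q \<in> carrier R" "f = x * q" using divide_in_R[OF x(2)] by blast
    then show "f \<in> (*) x ` carrier R" by auto
  qed
  then show "cm_type R (ring_module R) \<noteq> \<infinity>" unfolding type using enat_ile by blast
  \<comment> \<open>The series \<open>x / t\<close>, in general outside \<open>R\<close>; its
    exponents fall into \<open>H\<close> after adding 1.\<close>
  define x' where "x' = fps_shift 1 x"
  have xx': "x = fps_X * x'"
    using x(1) by (intro fps_ext) (auto simp: x'_def max_ideal_iff)
  then have x'nz: "x' \<noteq> 0" using x(2) by auto
  have x'supp: "fps_nth x' i \<noteq> 0 \<Longrightarrow> i + 1 \<in> H" for i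
    using x(1) by (auto simp: x'_def max_ideal_iff carrier_iff)
  \<comment> \<open>The pseudo-Frobenius numbers \<open>c - 1 - z\<close>, raised by one to stay
    natural.\<close>
  define P where "P = (\<lambda>z. c - z) ` gens"
  have P_add: "p + m - 1 \<in> H" if "p \<in> P" "m \<in> H" "m \<noteq> 0" for p m
    using that gens_dual by (auto simp: P_def)
  have P_notin: "p \<notin> Suc ` H" if "p \<in> P" for p
  proof
    assume "p \<in> Suc ` H"
    then obtain h z where h: "h \<in> H" "z \<in> gens" "c - z = Suc h" using \<open>p \<in> P\<close> by (auto simp: P_def)
    then have "h + z + 1 = c" by simp
    then show False using h by (auto simp: gens_def KK_def)
  qed
  \<comment> \<open>After multiplication by \<open>x'\<close>, the successors of elements of
    \<open>H\<close> give \<open>x R\<close>, and the exponents in \<open>P\<close> give socle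
    elements. Raising \<open>s\<close> removes the latter one at a time.\<close>
  define Q where "Q s = Suc ` H \<union> {p \<in> P. s \<le> p}" for s
  have Q_add: "q + h \<in> Q s" if qh: "q \<in> Q s" "h \<in> H" for q h s
  proof (cases "h = 0")
    case False
    then show ?thesis
    proof (cases "q \<in> P")
      case True
      then have "q + h = Suc (q + h - 1)" "q + h - 1 \<in> H" using False P_add that by auto
      then show ?thesis unfolding Q_def by blast
    next
      case False
      then obtain k where "q = Suc k" "k \<in> H" using qh by (auto simp: Q_def)
      then show ?thesis using qh(2) add_in_H by (auto simp: Q_def)
    qed
  qed (use that in simp)
  define D where "D s = (*) x' ` {g. \<forall>n. fps_nth g n \<noteq> 0 \<longrightarrow> n \<in> Q s}" for s
  have D_R: "D s \<subseteq> carrier R" for s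
  proof
    fix f assume "f \<in> D s"
    then obtain g where g: "f = x' * g" "\<And>n. fps_nth g n \<noteq> 0 \<Longrightarrow> n \<in> Q s" by (auto simp: D_def)
    have "n \<in> H" if nz: "fps_nth (x' * g) n \<noteq> 0" for n
    proof -
      obtain i j where ij: "i + 1 \<in> H" "j \<in> Q s" "n = i + j"
        using supp_mult[of x' "{i. i + 1 \<in> H}" g "Q s" n, OF _ _ nz] x'supp g(2) by auto
      show ?thesis
      proof (cases "j \<in> P")
        case True
        then show ?thesis using P_add[of j "i + 1"] ij by (simp add: add.commute)
      next
        case False
        then obtain k where "j = Suc k" "k \<in> H" using ij by (auto simp: Q_def)
        then show ?thesis using add_in_H[OF ij(1), of k] ij by simp
      qed
    qed
    then show "f \<in> carrier R" by (simp add: carrier_iff g(1))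
  qed
  have "enat (card P) \<le> cm_type R (ring_module R)"
    unfolding type
  proof (rule quot_length_geI[where D = D and L = "Suc c"])
    fix s assume "s \<le> Suc c"
    show "submodule (D s) R (ring_module R) \<and> (*) x ` carrier R \<subseteq> D s \<and> D s \<subseteq> ?S"
    proof (intro conjI subsetI)
      show "submodule (D s) R (ring_module R)"
        unfolding submodule_ring_module_iff
      proof (intro conjI ballI)
        show "0 \<in> D s" unfolding D_def by (rule image_eqI[of _ _ 0]) auto
      next
        fix f g assume "f \<in> D s" "g \<in> D s"
        then obtain f' g' where fg: "f = x' * f'" "g = x' * g'"
          "\<forall>n. fps_nth f' n \<noteq> 0 \<longrightarrow> n \<in> Q s" "\<forall>n. fps_nth g' n \<noteq> 0 \<longrightarrow> n \<in> Q s" by (auto simp: D_def)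
        have "n \<in> Q s" if "fps_nth f' n + fps_nth g' n \<noteq> 0" for n
          using fg(3,4) that by (metis add_0)
        then show "f + g \<in> D s" unfolding D_def fg(1,2)
          by (intro image_eqI[of _ _ "f' + g'"]) (auto simp: distrib_left)
      next
        fix a f assume a: "a \<in> carrier R" and "f \<in> D s"
        then obtain f' where f: "f = x' * f'" "\<And>n. fps_nth f' n \<noteq> 0 \<Longrightarrow> n \<in> Q s" by (auto simp: D_def)
        have "n \<in> Q s" if nz: "fps_nth (f' * a) n \<noteq> 0" for n
        proof -
          obtain i j where "i \<in> Q s" "j \<in> H" "n = i + j"
            using supp_mult[of f' "Q s" a H n, OF f(2) _ nz] a by (auto simp: carrier_iff)
          then show ?thesis using Q_add by simp
        qed
        then show "a * f \<in> D s" unfolding D_def f(1)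
          by (intro image_eqI[of _ _ "f' * a"]) (auto simp: ac_simps)
      qed (rule D_R)
    next
      fix f assume "f \<in> (*) x ` carrier R"
      then obtain g where g: "g \<in> carrier R" "f = x * g" by auto
      have "fps_nth (fps_X * g) n \<noteq> 0 \<Longrightarrow> n \<in> Q s" for n
        using g(1) by (cases n) (auto simp: carrier_iff Q_def)
      then show "f \<in> D s" unfolding D_def g(2) xx'
        by (intro image_eqI[of _ _ "fps_X * g"]) (auto simp: ac_simps)
    next
      fix f assume f: "f \<in> D s"
      then obtain g where g: "f = x' * g" "\<And>n. fps_nth g n \<noteq> 0 \<Longrightarrow> n \<in> Q s" by (auto simp: D_def)
      have "a * f \<in> (*) x ` carrier R" if a: "a \<in> max_ideal R" for a
      proof -
        \<comment> \<open>Adding a nonzero element of \<open>H\<close> moves both kinds of exponent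
          into the successors of \<open>H\<close>, so the product with \<open>x'\<close> is a
          multiple of \<open>x\<close>.\<close>
        have supp: "n \<in> Suc ` H" if nz: "fps_nth (a * g) n \<noteq> 0" for n
        proof -
          obtain i j where ij: "i \<in> H \<and> i \<noteq> 0" "j \<in> Q s" "n = i + j"
            using supp_mult[of a "{i. i \<in> H \<and> i \<noteq> 0}" g "Q s" n, OF _ g(2) nz]
              max_ideal_supp[OF a] by auto
          show ?thesis
          proof (cases "j \<in> P")
            case True
            then have "n = Suc (j + i - 1)" "j + i - 1 \<in> H" using P_add ij by auto
            then show ?thesis by blast
          next
            case False
            then obtain k where "j = Suc k" "k \<in> H" using ij by (auto simp: Q_def)
            then show ?thesis using add_in_H[of i k] ij by auto
          qed
        qed
        have "a * g = fps_X * fps_shift 1 (a * g)"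
          using supp[of 0] by (intro fps_ext) (auto simp del: fps_mult_nth_0)
        moreover have "fps_shift 1 (a * g) \<in> carrier R"
          using supp by (auto simp: carrier_iff)
        ultimately show ?thesis
          unfolding g(1) xx' by (intro image_eqI[of _ _ "fps_shift 1 (a * g)"]) (auto simp: ac_simps)
      qed
      then show "f \<in> ?S" using f D_R by auto
    qed
  next
    fix s assume s: "s \<in> P"
    then have le: "s < Suc c" by (auto simp: P_def)
    have "x' * fps_X ^ s \<in> D s"
      unfolding D_def using s by (intro image_eqI[of _ _ "fps_X ^ s"]) (auto simp: Q_def fps_X_power_nth)
    moreover have "x' * fps_X ^ s \<notin> D (Suc s)"
    proof
      assume "x' * fps_X ^ s \<in> D (Suc s)"
      then have "\<forall>n. fps_nth (fps_X ^ s :: 'k fps) n \<noteq> 0 \<longrightarrow> n \<in> Q (Suc s)"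
        using x'nz by (auto simp: D_def)
      then have "s \<in> Q (Suc s)" by (auto simp: fps_X_power_nth)
      then show False using P_notin[OF s] by (auto simp: Q_def)
    qed
    ultimately show "s < Suc c \<and> D s \<noteq> D (Suc s)" using le by blast
  next
    fix s show "D (Suc s) \<subseteq> D s" unfolding D_def Q_def by (intro image_mono) auto
  qed
  moreover have "card P = card gens"
    unfolding P_def using gens_le by (intro card_image inj_onI) (metis diff_diff_cancel)
  ultimately show "enat (card gens) \<le> cm_type R (ring_module R)" by simp
qed

text \<open>Nonzero elements of \<open>H\<close> are at least \<open>e\<close>, so the members of
  \<open>KK\<close> below \<open>e\<close> are minimal generators. Sums of generators therefore
  reach every number below \<open>e\<close>.\<close>

lemma e_le_rohrbach:
  assumes "\<And>z. \<exists>k\<in>KK. \<exists>l\<in>KK. z = k + l"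
  shows "int e \<le> rohrbach_max (the_enat (cm_type R (ring_module R)))"
proof (rule le_rohrbach_max[OF finite_gens])
  show "card gens \<le> the_enat (cm_type R (ring_module R))"
    using type_ring_bounds by auto
  show "e > 0" by (rule e_pos)
  fix n assume n: "n < e"
  obtain k l where kl: "k \<in> KK" "l \<in> KK" "n = k + l" using assms by blast
  have "k \<in> gens" if "k \<in> KK" "k < e" for k
  proof -
    have "\<not> m \<le> k" if "m \<in> H" "m \<noteq> 0" for m using e_le[OF that] \<open>k < e\<close> by simp
    then show ?thesis using that by (auto simp: gens_def)
  qed
  then have "k \<in> gens" "l \<in> gens" using kl n by auto
  then show "n \<in> {a + b | a b. a \<in> gens \<and> b \<in> gens}" using kl(3) by blast
qed

end

section \<open>Modules of type one\<close>

text \<open>Each strict step loses an element, and the lost elements are distinct because they never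
  return.\<close>

lemma card_le_of_strict_descent:
  fixes V :: "nat \<Rightarrow> 'b set"
  assumes "finite (V 0)" "\<And>s. V (Suc s) \<subseteq> V s" "\<And>p. p \<in> G \<Longrightarrow> V (Suc p) \<noteq> V p"
  shows "card G \<le> card (V 0)"
proof -
  have anti: "V t \<subseteq> V s" if "s \<le> t" for s t
    using that by (rule lift_Suc_antimono_le[of V, OF assms(2)])
  have "\<forall>p\<in>G. \<exists>v. v \<in> V p - V (Suc p)" using assms(2,3) by blast
  then obtain g where g: "\<And>p. p \<in> G \<Longrightarrow> g p \<in> V p - V (Suc p)" by metis
  have "g p \<noteq> g q" if "p \<in> G" "q \<in> G" "p < q" for p q
    using g[OF that(1)] g[OF that(2)] anti[of "Suc p" q] that(3) by auto
  then have "inj_on g G" by (metis linorder_inj_onI')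
  moreover have "g ` G \<subseteq> V 0" using g anti[of 0] by auto
  ultimately show ?thesis using assms(1) by (metis card_inj_on_le)
qed

text \<open>For \<open>N > 0\<close>, each residue class modulo \<open>N\<close> contributes its
  least member. The proof counts the members below \<open>b + N\<close> in two ways.\<close>

lemma card_shift_complement:
  fixes \<Gamma> :: "nat set"
  assumes shift: "\<And>g. g \<in> \<Gamma> \<Longrightarrow> N + g \<in> \<Gamma>" and cofin: "\<And>n. n \<ge> b \<Longrightarrow> n \<in> \<Gamma>"
  shows "finite (\<Gamma> - (+) N ` \<Gamma>)" "card (\<Gamma> - (+) N ` \<Gamma>) = N"
proof -
  let ?G = "\<Gamma> - (+) N ` \<Gamma>"
  have G: "?G \<subseteq> {..<b + N}"
  proof
    fix g assume g: "g \<in> ?G"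
    show "g \<in> {..<b + N}"
    proof (rule ccontr)
      assume "g \<notin> {..<b + N}"
      then have "g - N \<in> \<Gamma>" "g = N + (g - N)" using cofin by auto
      then show False using g by blast
    qed
  qed
  then show fin: "finite ?G" by (rule finite_subset) simp
  have "\<Gamma> \<inter> {..<b + N} = (\<Gamma> \<inter> {..<b}) \<union> {b..<b + N}" using cofin by auto
  moreover have "(\<Gamma> \<inter> {..<b}) \<inter> {b..<b + N} = {}" by auto
  ultimately have 1: "card (\<Gamma> \<inter> {..<b + N}) = card (\<Gamma> \<inter> {..<b}) + N"
    by (simp add: card_Un_disjoint)
  have "\<Gamma> \<inter> {..<b + N} = ?G \<union> (+) N ` (\<Gamma> \<inter> {..<b})" using G shift by auto
  moreover have "?G \<inter> (+) N ` (\<Gamma> \<inter> {..<b}) = {}" by auto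
  ultimately have "card (\<Gamma> \<inter> {..<b + N}) = card ?G + card ((+) N ` (\<Gamma> \<inter> {..<b}))"
    using fin by (simp add: card_Un_disjoint)
  also have "card ((+) N ` (\<Gamma> \<inter> {..<b})) = card (\<Gamma> \<inter> {..<b})" by (simp add: card_image)
  finally show "card ?G = N" using 1 by simp
qed

section \<open>Spans and the Nakayama lemma\<close>

context plain_module
begin

lemma submodule_span:
  assumes "S \<subseteq> carrier M"
  shows "submodule (submodule_span R M S) R M" "S \<subseteq> submodule_span R M S"
proof -
  show "S \<subseteq> submodule_span R M S" unfolding submodule_span_def by blast
  show "submodule (submodule_span R M S) R M"
  proof (rule submoduleI)
    show "submodule_span R M S \<subseteq> carrier M"
      unfolding submodule_span_def using carrier_is_submodule assms by blast
    show "\<zero>\<^bsub>M\<^esub> \<in> submodule_span R M S"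
      unfolding submodule_span_def using submodule.axioms(1) subgroup.one_closed by fastforce
  qed (use submoduleE(3-5) in \<open>unfold submodule_span_def; blast\<close>)+
qed

lemma submodule_span_minimal: "submodule N R M \<Longrightarrow> S \<subseteq> N \<Longrightarrow> submodule_span R M S \<subseteq> N"
  unfolding submodule_span_def by blast

lemma submodule_zero: "submodule N R M \<Longrightarrow> \<zero>\<^bsub>M\<^esub> \<in> N"
  using submodule.axioms(1) subgroup.one_closed by fastforce

lemma submodule_sum_single:
  assumes Y: "submodule Y R M" and g: "g \<in> carrier M"
  shows "submodule {b \<odot>\<^bsub>M\<^esub> g \<oplus>\<^bsub>M\<^esub> s | b s. b \<in> carrier R \<and> s \<in> Y} R M" (is "submodule ?Z R M")
proof (rule submoduleI)
  note Ysub = subsetD[OF submoduleE(1)[OF Y]]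
  show "?Z \<subseteq> carrier M" using Ysub g by auto
  show "\<zero>\<^bsub>M\<^esub> \<in> ?Z"
    using g submodule_zero[OF Y] by (intro CollectI exI[of _ \<zero>] exI[of _ "\<zero>\<^bsub>M\<^esub>"]) auto
next
  note Ysub = subsetD[OF submoduleE(1)[OF Y]]
  fix u assume "u \<in> ?Z"
  then obtain b s where u: "u = b \<odot>\<^bsub>M\<^esub> g \<oplus>\<^bsub>M\<^esub> s" "b \<in> carrier R" "s \<in> Y" by auto
  {
    show "\<ominus>\<^bsub>M\<^esub> u \<in> ?Z"
      using u Ysub g submoduleE(3)[OF Y]
      by (intro CollectI exI[of _ "\<ominus> b"] exI[of _ "\<ominus>\<^bsub>M\<^esub> s"]) (auto simp: smult_l_minus M.minus_add)
  next
    fix v assume "v \<in> ?Z"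
    then obtain b' s' where v: "v = b' \<odot>\<^bsub>M\<^esub> g \<oplus>\<^bsub>M\<^esub> s'" "b' \<in> carrier R" "s' \<in> Y" by auto
    show "u \<oplus>\<^bsub>M\<^esub> v \<in> ?Z"
      using u v Ysub g submoduleE(5)[OF Y]
      by (intro CollectI exI[of _ "b \<oplus> b'"] exI[of _ "s \<oplus>\<^bsub>M\<^esub> s'"]) (auto simp: smult_l_distr M.a_ac)
  next
    fix a assume "a \<in> carrier R"
    then show "a \<odot>\<^bsub>M\<^esub> u \<in> ?Z"
      using u Ysub g submoduleE(4)[OF Y]
      by (intro CollectI exI[of _ "a \<otimes> b"] exI[of _ "a \<odot>\<^bsub>M\<^esub> s"]) (auto simp: smult_r_distr smult_assoc1)
  }
qed

text \<open>Generators are removed from \<open>G\<close> one at a time: for a generator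
  \<open>g\<close>, some \<open>(1 - y b) g\<close> lies in the span of \<open>X\<close> and the
  remaining ones, and \<open>1 - y b\<close> is a unit.\<close>

lemma nakayama:
  assumes y: "y \<in> carrier R" "\<And>b. b \<in> carrier R \<Longrightarrow> \<one> \<ominus> y \<otimes> b \<in> Units R"
    and X: "submodule X R M" and G: "finite G" "G \<subseteq> carrier M"
    and span: "submodule_span R M (X \<union> G) = carrier M"
    and sum: "\<And>w. w \<in> carrier M \<Longrightarrow> \<exists>u\<in>X. \<exists>v\<in>carrier M. w = u \<oplus>\<^bsub>M\<^esub> y \<odot>\<^bsub>M\<^esub> v"
  shows "X = carrier M"
  using G span
proof (induction G rule: finite_induct)
  case empty
  then show ?case using submodule_span_minimal[OF X, of X] submoduleE(1)[OF X] by auto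
next
  case (insert g G)
  define Y where "Y = submodule_span R M (X \<union> G)"
  have XG: "X \<union> G \<subseteq> carrier M" and g: "g \<in> carrier M" using insert.prems submoduleE(1)[OF X] by auto
  have Y: "submodule Y R M" "X \<union> G \<subseteq> Y" using submodule_span[OF XG] by (auto simp: Y_def)
  note Ysub = subsetD[OF submoduleE(1)[OF Y(1)]]
  let ?Z = "{b \<odot>\<^bsub>M\<^esub> g \<oplus>\<^bsub>M\<^esub> s | b s. b \<in> carrier R \<and> s \<in> Y}"
  have "s \<in> ?Z" if "s \<in> Y" for s
    using that Ysub g by (intro CollectI exI[of _ \<zero>] exI[of _ s]) auto
  moreover have "g \<in> ?Z"
    using g submodule_zero[OF Y(1)] by (intro CollectI exI[of _ \<one>] exI[of _ "\<zero>\<^bsub>M\<^esub>"]) auto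
  ultimately have "X \<union> insert g G \<subseteq> ?Z" using Y(2) by auto
  then have "submodule_span R M (X \<union> insert g G) \<subseteq> ?Z"
    by (rule submodule_span_minimal[OF submodule_sum_single[OF Y(1) g]])
  then have Z: "carrier M \<subseteq> ?Z" unfolding insert.prems(2) .
  \<comment> \<open>Expanding \<open>v\<close> over \<open>g\<close> and \<open>Y\<close> produces
    the equation \<open>g = y b g + r\<close> with \<open>r\<close> in \<open>Y\<close>.\<close>
  obtain u v where uv: "u \<in> X" "v \<in> carrier M" "g = u \<oplus>\<^bsub>M\<^esub> y \<odot>\<^bsub>M\<^esub> v" using sum[OF g] by auto
  obtain b s where bs: "b \<in> carrier R" "s \<in> Y" "v = b \<odot>\<^bsub>M\<^esub> g \<oplus>\<^bsub>M\<^esub> s" using Z uv(2) by auto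
  have car: "u \<in> carrier M" "s \<in> carrier M" using uv(1) XG bs(2) Ysub by auto
  define r where "r = u \<oplus>\<^bsub>M\<^esub> y \<odot>\<^bsub>M\<^esub> s"
  have rY: "r \<in> Y" unfolding r_def using uv(1) Y bs(2) y(1) submoduleE(4,5)[OF Y(1)] by auto
  have rc: "r \<in> carrier M" using rY Ysub by auto
  have eq: "g = (y \<otimes> b) \<odot>\<^bsub>M\<^esub> g \<oplus>\<^bsub>M\<^esub> r"
    using uv(3) car y(1) bs(1) g unfolding bs(3) r_def
    by (simp add: smult_r_distr smult_assoc1 M.a_ac)
  have "(\<one> \<ominus> y \<otimes> b) \<odot>\<^bsub>M\<^esub> g = g \<oplus>\<^bsub>M\<^esub> \<ominus>\<^bsub>M\<^esub> ((y \<otimes> b) \<odot>\<^bsub>M\<^esub> g)"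
    using y(1) bs(1) g by (simp add: R.minus_eq smult_l_distr smult_l_minus)
  also have "\<dots> = r"
    using eq y(1) bs(1) g rc by (metis M.add.m_comm M.add.inv_solve_right' R.m_closed smult_closed)
  finally have r: "(\<one> \<ominus> y \<otimes> b) \<odot>\<^bsub>M\<^esub> g = r" .
  define q where "q = \<one> \<ominus> y \<otimes> b"
  have q: "q \<in> Units R" "q \<in> carrier R" using y(2)[OF bs(1)] by (auto simp: q_def)
  have "g = inv q \<odot>\<^bsub>M\<^esub> (q \<odot>\<^bsub>M\<^esub> g)" using q g by (simp flip: smult_assoc1)
  also have "\<dots> \<in> Y" using r rY submoduleE(4)[OF Y(1)] q by (simp add: q_def)
  finally have "X \<union> insert g G \<subseteq> Y" using Y(2) by auto
  then have "submodule_span R M (X \<union> insert g G) \<subseteq> Y" by (rule submodule_span_minimal[OF Y(1)])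
  then have "carrier M \<subseteq> Y" unfolding insert.prems(2) .
  then have "Y = carrier M" using Ysub by auto
  then show ?case using insert.IH insert.prems(1) by (auto simp: Y_def)
qed

end

section \<open>The regular element \<open>y\<close> and the ring modulo \<open>y\<close>\<close>

context numerical_semigroup_ring
begin

text \<open>The exponent \<open>c + 1\<close> is nonzero even for \<open>c = 0\<close>, and makes
  \<open>y\<close> times any power series an element of \<open>R\<close>.\<close>

definition y :: "'k fps" where "y = fps_X ^ (c + 1)"

text \<open>The Apery set of \<open>H\<close> with respect to \<open>c + 1\<close>: its monomials
  form a basis of \<open>R / y R\<close> over the field.\<close>

definition B :: "nat set" where "B = H - (+) (c + 1) ` H"

text \<open>\<open>\<rho>\<close> orders \<open>B\<close> so that multiplication by \<open>t^m\<close> moves upwards, with \<open>2c\<close> directly below the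
  exponents of \<open>y CC\<close>.  As \<open>2c = (c + 1) + (c - 1)\<close>, it corresponds to the Frobenius number, the
  exponent of the socle of \<open>CC / y CC\<close>.\<close>

definition \<rho> :: "nat \<Rightarrow> nat" where
  "\<rho> h = h + (2 * c + 1) * (if h \<in> (+) (c + 1) ` KK then 2 else if h = 2 * c then 1 else 0)"

lemma y_in_R: "y \<in> carrier R" and y_nz: "y \<noteq> 0" and y_max: "y \<in> max_ideal R"
  and subdegree_y: "subdegree y = c + 1"
  using monom_in_max[of "c + 1"] ge_c[of "c + 1"] by (auto simp: y_def max_ideal_iff fps_X_power_subdegree simp del: power_Suc power_add)

lemma B_le: "h \<in> B \<Longrightarrow> h \<le> 2 * c"
proof (rule ccontr)
  assume "h \<in> B" "\<not> h \<le> 2 * c"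
  moreover from this have "h - (c + 1) \<in> H" "h = c + 1 + (h - (c + 1))" using ge_c by auto
  ultimately show False unfolding B_def by blast
qed

lemma finite_B: "finite B" and card_B: "card B = c + 1"
  unfolding B_def using card_shift_complement[of H "c + 1" c] ge_c add_in_H[of "c + 1"] by auto

lemma zero_in_B: "0 \<in> B"
  by (auto simp: B_def)

text \<open>Subtracting \<open>c + 1\<close> from \<open>2 * c\<close> leaves \<open>c - 1\<close>,
  which is not in \<open>H\<close>.\<close>

lemma two_c_in_B: "2 * c \<in> B"
proof -
  have "2 * c \<noteq> c + 1 + k" if "k \<in> H" for k using c_pred[OF that] by simp
  then show ?thesis using ge_c[of "2 * c"] by (auto simp: B_def)
qed

text \<open>The three levels of \<open>\<rho>\<close> never fall when an element of \<open>H\<close>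
  is added: the shifted \<open>KK\<close> is stable, and \<open>2 * c\<close> moves into it.\<close>

lemma \<rho>_less: "m \<in> H \<Longrightarrow> m \<noteq> 0 \<Longrightarrow> \<rho> h < \<rho> (h + m)"
proof -
  assume m: "m \<in> H" "m \<noteq> 0"
  show ?thesis
  proof (cases "h \<in> (+) (c + 1) ` KK")
    case True
    then obtain k where "k \<in> KK" "h = c + 1 + k" by auto
    then have "h + m = c + 1 + (m + k)" "m + k \<in> KK" using KK_add m by auto
    then have "h + m \<in> (+) (c + 1) ` KK" by blast
    then show ?thesis using True m by (simp add: \<rho>_def)
  next
    case False
    show ?thesis
    proof (cases "h = 2 * c")
      case True
      then have "h + m = c + 1 + (c + m - 1)" "c + m - 1 \<in> KK" using m ge_c_in_KK by auto
      then have "h + m \<in> (+) (c + 1) ` KK" by blast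
      then show ?thesis using True False m by (simp add: \<rho>_def)
    qed (use False m in \<open>simp add: \<rho>_def\<close>)
  qed
qed

text \<open>Elements of \<open>B\<close> are below \<open>2 * c + 1\<close>, so \<open>h\<close> is
  recovered as a remainder of \<open>\<rho> h\<close>.\<close>

lemma \<rho>_inj: "inj_on \<rho> B"
proof (rule inj_on_inverseI)
  fix h assume "h \<in> B"
  then have "h < 2 * c + 1" using B_le[of h] by simp
  then show "\<rho> h mod (2 * c + 1) = h" unfolding \<rho>_def by (simp only: mod_mult_self2 mod_less)
qed

end

text \<open>The last assumption bounds the dimension of the socle of \<open>W / x W\<close> by 1 for
  every nonzero non-unit \<open>x\<close>, phrased as linear dependence of any two socle elements
  over the field.\<close>

locale type_one_module = numerical_semigroup_ring H R + plain_module R W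
  for H and R :: "'k::field fps ring" and W :: "('k fps, 'm) module" +
  assumes torsion_free: "a \<in> carrier R \<Longrightarrow> v \<in> carrier W \<Longrightarrow> a \<odot>\<^bsub>W\<^esub> v = \<zero>\<^bsub>W\<^esub> \<Longrightarrow> a = 0 \<or> v = \<zero>\<^bsub>W\<^esub>"
    and socle: "\<And>x u v. x \<in> max_ideal R \<Longrightarrow> x \<noteq> 0 \<Longrightarrow> u \<in> carrier W \<Longrightarrow> v \<in> carrier W \<Longrightarrow>
      (\<And>a. a \<in> max_ideal R \<Longrightarrow> a \<odot>\<^bsub>W\<^esub> u \<in> (\<lambda>v. x \<odot>\<^bsub>W\<^esub> v) ` carrier W) \<Longrightarrow>
      (\<And>a. a \<in> max_ideal R \<Longrightarrow> a \<odot>\<^bsub>W\<^esub> v \<in> (\<lambda>v. x \<odot>\<^bsub>W\<^esub> v) ` carrier W) \<Longrightarrow>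
      \<exists>k l. (k \<noteq> 0 \<or> l \<noteq> 0) \<and>
        fps_const k \<odot>\<^bsub>W\<^esub> u \<oplus>\<^bsub>W\<^esub> fps_const l \<odot>\<^bsub>W\<^esub> v \<in> (\<lambda>v. x \<odot>\<^bsub>W\<^esub> v) ` carrier W"
begin

lemma smult_mult: "a \<in> carrier R \<Longrightarrow> b \<in> carrier R \<Longrightarrow> v \<in> carrier W \<Longrightarrow> (a * b) \<odot>\<^bsub>W\<^esub> v = a \<odot>\<^bsub>W\<^esub> (b \<odot>\<^bsub>W\<^esub> v)"
  using smult_assoc1[of a b v] by simp

lemma smult_add: "a \<in> carrier R \<Longrightarrow> b \<in> carrier R \<Longrightarrow> v \<in> carrier W \<Longrightarrow> (a + b) \<odot>\<^bsub>W\<^esub> v = a \<odot>\<^bsub>W\<^esub> v \<oplus>\<^bsub>W\<^esub> b \<odot>\<^bsub>W\<^esub> v"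
  using smult_l_distr[of a b v] by simp

lemma smult_1 [simp]: "v \<in> carrier W \<Longrightarrow> 1 \<odot>\<^bsub>W\<^esub> v = v"
  using smult_one by simp

lemma smult_0 [simp]: "v \<in> carrier W \<Longrightarrow> 0 \<odot>\<^bsub>W\<^esub> v = \<zero>\<^bsub>W\<^esub>"
  using smult_l_null by simp

lemma smult_cancel:
  assumes "a \<in> carrier R" "a \<noteq> 0" "u \<in> carrier W" "v \<in> carrier W" "a \<odot>\<^bsub>W\<^esub> u = a \<odot>\<^bsub>W\<^esub> v"
  shows "u = v"
proof -
  have "a \<odot>\<^bsub>W\<^esub> (u \<ominus>\<^bsub>W\<^esub> v) = \<zero>\<^bsub>W\<^esub>"
    using assms by (simp add: M.minus_eq smult_r_distr smult_r_minus M.r_neg)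
  then have "u \<ominus>\<^bsub>W\<^esub> v = \<zero>\<^bsub>W\<^esub>" using torsion_free[OF assms(1), of "u \<ominus>\<^bsub>W\<^esub> v"] assms by auto
  then have "u \<oplus>\<^bsub>W\<^esub> \<ominus>\<^bsub>W\<^esub> v = \<zero>\<^bsub>W\<^esub>" by (simp add: M.minus_eq)
  then have "\<ominus>\<^bsub>W\<^esub> (\<ominus>\<^bsub>W\<^esub> v) = u" using assms(3,4) by (intro M.minus_equality) auto
  then show ?thesis using assms(4) by simp
qed

section \<open>The quotient of \<open>W\<close> by \<open>y\<close> and its valuation\<close>

definition yW :: "'m set" where "yW = (\<lambda>v. y \<odot>\<^bsub>W\<^esub> v) ` carrier W"

lemma submodule_yW: "submodule yW R W"
  unfolding yW_def by (rule submodule_smult_image[OF y_in_R])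

lemma yW_closed:
  "v \<in> yW \<Longrightarrow> v \<in> carrier W"
  "u \<in> yW \<Longrightarrow> v \<in> yW \<Longrightarrow> u \<oplus>\<^bsub>W\<^esub> v \<in> yW"
  "a \<in> carrier R \<Longrightarrow> v \<in> yW \<Longrightarrow> a \<odot>\<^bsub>W\<^esub> v \<in> yW"
  "v \<in> carrier W \<Longrightarrow> y \<odot>\<^bsub>W\<^esub> v \<in> yW"
  using submoduleE[OF submodule_yW] by (auto simp: yW_def)

text \<open>Membership in \<open>yW\<close> can be tested on monomials: terms are split off from the
  lowest exponent upwards, and a remainder of order above \<open>2 * c\<close> is divisible by
  \<open>y\<close> in \<open>R\<close>.\<close>

lemma smult_in_yW:
  assumes w: "w \<in> carrier W" and j: "j \<in> carrier R"
    and supp: "\<And>n. fps_nth j n \<noteq> 0 \<Longrightarrow> n \<le> 2 * c \<Longrightarrow> fps_X ^ n \<odot>\<^bsub>W\<^esub> w \<in> yW"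
  shows "j \<odot>\<^bsub>W\<^esub> w \<in> yW"
proof -
  \<comment> \<open>Downward induction on a lower bound \<open>s\<close> for the order; it starts at
    \<open>2 * c + 1\<close>, the order of \<open>y\<close> plus \<open>c\<close>.\<close>
  have "\<forall>j\<in>carrier R. (\<forall>n. fps_nth j n \<noteq> 0 \<longrightarrow> n \<le> 2 * c \<longrightarrow> fps_X ^ n \<odot>\<^bsub>W\<^esub> w \<in> yW) \<longrightarrow>
      (\<forall>i<s. fps_nth j i = 0) \<longrightarrow> j \<odot>\<^bsub>W\<^esub> w \<in> yW" if "s \<le> 2 * c + 1" for s
    using that
  proof (induction s rule: inc_induct)
    case base
    show ?case
    proof (intro ballI impI)
      fix j :: "'k fps" assume "\<forall>i<2 * c + 1. fps_nth j i = 0"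
      then have "\<And>i. i < subdegree y + c \<Longrightarrow> fps_nth j i = 0" by (simp add: subdegree_y)
      then obtain q where "q \<in> carrier R" "j = y * q" using divide_in_R[OF y_nz, of j] by blast
      then show "j \<odot>\<^bsub>W\<^esub> w \<in> yW" using w y_in_R by (simp add: smult_mult yW_closed)
    qed
  next
    case (step s)
    show ?case
    proof (intro ballI impI)
      fix j assume j: "j \<in> carrier R" "\<forall>n. fps_nth j n \<noteq> 0 \<longrightarrow> n \<le> 2 * c \<longrightarrow> fps_X ^ n \<odot>\<^bsub>W\<^esub> w \<in> yW"
        "\<forall>i<s. fps_nth j i = 0"
      show "j \<odot>\<^bsub>W\<^esub> w \<in> yW"
      proof (cases "fps_nth j s = 0")
        case True
        then show ?thesis using step.IH j by (metis less_SucE)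
      next
        case False
        then have s: "fps_X ^ s \<in> carrier R" using j(1) by (simp add: monom_in_R carrier_iff)
        define a where "a = fps_const (fps_nth j s) * fps_X ^ s"
        have "fps_X ^ s \<odot>\<^bsub>W\<^esub> w \<in> yW" using False j(2) step.hyps by simp
        then have a: "a \<in> carrier R" "a \<odot>\<^bsub>W\<^esub> w \<in> yW"
          unfolding a_def using s w in_R(3,7) by (auto simp: smult_mult yW_closed(3))
        have "\<forall>i<Suc s. fps_nth (j - a) i = 0" using j(3) by (auto simp: a_def fps_X_power_nth less_Suc_eq)
        moreover have "\<forall>n. fps_nth (j - a) n \<noteq> 0 \<longrightarrow> n \<le> 2 * c \<longrightarrow> fps_X ^ n \<odot>\<^bsub>W\<^esub> w \<in> yW"
          using j(2) by (auto simp: a_def fps_X_power_nth split: if_splits)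
        moreover have "j - a \<in> carrier R" using j(1) a(1) in_R by simp
        ultimately have "(j - a) \<odot>\<^bsub>W\<^esub> w \<in> yW" using step.IH by blast
        then show ?thesis
          using smult_add[OF \<open>j - a \<in> carrier R\<close> a(1) w] a(2) by (simp add: yW_closed(2))
      qed
    qed
  qed
  from this[of 0] show ?thesis using j supp by auto
qed

definition T :: "'m \<Rightarrow> nat set" where "T w = {h \<in> B. fps_X ^ h \<odot>\<^bsub>W\<^esub> w \<notin> yW}"

text \<open>\<open>val\<close> plays the role of a valuation on \<open>W / y W\<close>; for \<open>w \<in> yW\<close> the maximum is over the empty set
  and has no meaning.\<close>

definition val :: "'m \<Rightarrow> nat" where "val w = Max (\<rho> ` T w)"

lemma B_in_R: "h \<in> B \<Longrightarrow> fps_X ^ h \<in> carrier R"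
  by (simp add: monom_in_R B_def)

lemma val_eqI: "h \<in> T w \<Longrightarrow> (\<And>h'. h' \<in> T w \<Longrightarrow> \<rho> h' \<le> \<rho> h) \<Longrightarrow> val w = \<rho> h"
  unfolding val_def T_def using finite_B by (intro Max_eqI) auto

lemma val_top:
  assumes "w \<in> carrier W - yW"
  obtains h where "h \<in> T w" "val w = \<rho> h" "\<And>h'. h' \<in> T w \<Longrightarrow> \<rho> h' \<le> \<rho> h"
proof -
  have fin: "finite (T w)" unfolding T_def using finite_B by simp
  have "0 \<in> T w" using assms zero_in_B by (simp add: T_def)
  then have "val w \<in> \<rho> ` T w" unfolding val_def using fin by (intro Max_in) auto
  then obtain h where "h \<in> T w" "val w = \<rho> h" by blast
  moreover have "\<rho> h' \<le> val w" if "h' \<in> T w" for h' unfolding val_def using that fin by simp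
  ultimately show ?thesis using that[of h] by simp
qed

lemma val_in: "w \<in> carrier W - yW \<Longrightarrow> val w \<in> \<rho> ` B"
  using val_top[of w] by (auto simp: T_def elim: val_top)

lemma monom_notin_B: "h \<in> H \<Longrightarrow> h \<notin> B \<Longrightarrow> w \<in> carrier W \<Longrightarrow> fps_X ^ h \<odot>\<^bsub>W\<^esub> w \<in> yW"
proof -
  assume h: "h \<in> H" "h \<notin> B" and w: "w \<in> carrier W"
  then obtain k where k: "k \<in> H" "h = c + 1 + k" by (auto simp: B_def)
  have "fps_X ^ h = y * fps_X ^ k" unfolding y_def k(2) by (rule power_add)
  then show ?thesis using w k(1) y_in_R by (simp add: smult_mult monom_in_R yW_closed)
qed

text \<open>Every exponent of \<open>fps_X ^ h * a\<close> is \<open>h\<close> plus a nonzero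
  element of \<open>H\<close>, so it has larger \<open>\<rho>\<close> and lies outside
  \<open>T w\<close>.\<close>

lemma top_in_socle:
  assumes w: "w \<in> carrier W" and h: "h \<in> H" and top: "\<And>h'. h' \<in> T w \<Longrightarrow> \<rho> h' \<le> \<rho> h" and a: "a \<in> max_ideal R"
  shows "a \<odot>\<^bsub>W\<^esub> (fps_X ^ h \<odot>\<^bsub>W\<^esub> w) \<in> yW"
proof -
  have aR: "a \<in> carrier R" "fps_X ^ h \<in> carrier R" using a h by (auto simp: max_ideal_iff monom_in_R)
  have "(fps_X ^ h * a) \<odot>\<^bsub>W\<^esub> w \<in> yW"
  proof (rule smult_in_yW[OF w])
    show "fps_X ^ h * a \<in> carrier R" using aR in_R by simp
    fix n assume "fps_nth (fps_X ^ h * a) n \<noteq> 0"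
    then have "n \<ge> h" "fps_nth a (n - h) \<noteq> 0" by (auto simp: fps_X_power_mult_nth split: if_splits)
    then have n: "n - h \<in> H" "n - h \<noteq> 0" "n = h + (n - h)" using max_ideal_supp[OF a, of "n - h"] by auto
    then have "\<rho> h < \<rho> n" using \<rho>_less by metis
    then have "n \<notin> T w" using top[of n] by auto
    moreover have "n \<in> H" using n h add_in_H by metis
    ultimately show "fps_X ^ n \<odot>\<^bsub>W\<^esub> w \<in> yW" using monom_notin_B[OF _ _ w] by (auto simp: T_def)
  qed
  then show ?thesis using aR w by (simp add: mult.commute smult_mult)
qed

definition subspace :: "'m set \<Rightarrow> bool" where
  "subspace D \<longleftrightarrow> D \<subseteq> carrier W \<and> yW \<subseteq> D \<and> (\<forall>u\<in>D. \<forall>v\<in>D. u \<oplus>\<^bsub>W\<^esub> v \<in> D) \<and> (\<forall>v\<in>D. \<forall>k. fps_const k \<odot>\<^bsub>W\<^esub> v \<in> D)"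

text \<open>If \<open>d\<close> and \<open>d0\<close> have the same \<open>val = \<rho> h\<close>, then \<open>t^h d\<close> and \<open>t^h d0\<close> lie in the socle modulo \<open>y\<close>,
  which is one-dimensional, so a combination of \<open>d\<close> and \<open>d0\<close> has smaller \<open>val\<close>.\<close>

lemma val_strict_mono:
  assumes D: "subspace D" "subspace D'" "D \<subset> D'"
  shows "val ` (D - yW) \<subset> val ` (D' - yW)"
proof -
  \<comment> \<open>A missing element of minimal \<open>val\<close>; if \<open>D\<close> attained
    this value, the combination \<open>d1\<close> would undercut it.\<close>
  obtain d where d: "d \<in> D' - D" and min: "\<And>d'. d' \<in> D' - D \<Longrightarrow> val d \<le> val d'"
    using D(3) ex_has_least_nat[of "\<lambda>d. d \<in> D' - D" _ val] by (metis psubset_imp_ex_mem)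
  have dW: "d \<in> carrier W - yW" using d D by (auto simp: subspace_def)
  have "val d \<notin> val ` (D - yW)"
  proof
    assume "val d \<in> val ` (D - yW)"
    then obtain d0 where d0: "d0 \<in> D - yW" "val d0 = val d" by auto
    then have d0W: "d0 \<in> carrier W - yW" using D by (auto simp: subspace_def)
    obtain h where h: "h \<in> T d" "val d = \<rho> h" "\<And>h'. h' \<in> T d \<Longrightarrow> \<rho> h' \<le> \<rho> h" using val_top[OF dW] by metis
    obtain h0 where h0: "h0 \<in> T d0" "val d0 = \<rho> h0" "\<And>h'. h' \<in> T d0 \<Longrightarrow> \<rho> h' \<le> \<rho> h0" using val_top[OF d0W] by metis
    have "h0 = h" using h(1,2) h0(1,2) d0(2) \<rho>_inj by (auto simp: T_def inj_on_def)
    note h0 = h0[unfolded this]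
    have hB: "h \<in> B" "h \<in> H" "fps_X ^ h \<in> carrier R" using h(1) B_in_R by (auto simp: T_def B_def)
    have car: "d \<in> carrier W" "d0 \<in> carrier W" "fps_X ^ h \<odot>\<^bsub>W\<^esub> d \<in> carrier W" "fps_X ^ h \<odot>\<^bsub>W\<^esub> d0 \<in> carrier W"
      using dW d0W hB by auto
    obtain k l where kl: "k \<noteq> 0 \<or> l \<noteq> 0"
      "fps_const k \<odot>\<^bsub>W\<^esub> (fps_X ^ h \<odot>\<^bsub>W\<^esub> d) \<oplus>\<^bsub>W\<^esub> fps_const l \<odot>\<^bsub>W\<^esub> (fps_X ^ h \<odot>\<^bsub>W\<^esub> d0) \<in> yW"
      using socle[OF y_max y_nz car(3,4)] top_in_socle[OF car(1) hB(2) h(3)] top_in_socle[OF car(2) hB(2) h0(3)]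
      by (auto simp: yW_def)
    \<comment> \<open>Otherwise a nonzero scalar multiple of \<open>fps_X ^ h\<close> times
      \<open>d0\<close> would lie in \<open>yW\<close>, although \<open>h\<close> belongs to
      \<open>T d0\<close>.\<close>
    have "k \<noteq> 0"
    proof
      assume k: "k = 0"
      then have "fps_const l \<odot>\<^bsub>W\<^esub> (fps_X ^ h \<odot>\<^bsub>W\<^esub> d0) \<in> yW" using kl(2) car in_R(7) by simp
      then have "fps_const (1 / l) \<odot>\<^bsub>W\<^esub> (fps_const l \<odot>\<^bsub>W\<^esub> (fps_X ^ h \<odot>\<^bsub>W\<^esub> d0)) \<in> yW" using in_R(7) yW_closed(3) by blast
      moreover have "fps_const (1 / l) * fps_const l = (1 :: 'k fps)" using kl(1) k by simp
      ultimately have "fps_X ^ h \<odot>\<^bsub>W\<^esub> d0 \<in> yW" using car in_R(7) by (simp flip: smult_mult)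
      then show False using h0(1) by (simp add: T_def)
    qed
    \<comment> \<open>The socle relation divided by \<open>k\<close>: now \<open>fps_X ^ h\<close>
      sends \<open>d1\<close> into \<open>yW\<close>, and so do the monomials of larger
      \<open>\<rho>\<close>, as they did for \<open>d\<close> and \<open>d0\<close>.\<close>
    define d1 where "d1 = d \<oplus>\<^bsub>W\<^esub> fps_const (l / k) \<odot>\<^bsub>W\<^esub> d0"
    have ld0: "fps_const (l / k) \<odot>\<^bsub>W\<^esub> d0 \<in> D" using D(1) d0(1) by (auto simp: subspace_def)
    have ld0c: "fps_const (l / k) \<odot>\<^bsub>W\<^esub> d0 \<in> carrier W" using car in_R(7) by simp
    have d1: "d1 \<in> D' - D"
    proof
      show "d1 \<in> D'" unfolding d1_def using D d ld0 by (auto simp: subspace_def)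
      show "d1 \<notin> D"
      proof
        assume "d1 \<in> D"
        moreover have "fps_const (- 1) \<odot>\<^bsub>W\<^esub> (fps_const (l / k) \<odot>\<^bsub>W\<^esub> d0) \<in> D" using ld0 D(1) by (auto simp: subspace_def)
        ultimately have "d1 \<oplus>\<^bsub>W\<^esub> fps_const (- 1) \<odot>\<^bsub>W\<^esub> (fps_const (l / k) \<odot>\<^bsub>W\<^esub> d0) \<in> D" using D(1) by (auto simp: subspace_def)
        moreover have "fps_const (- 1) \<odot>\<^bsub>W\<^esub> (fps_const (l / k) \<odot>\<^bsub>W\<^esub> d0) = \<ominus>\<^bsub>W\<^esub> (fps_const (l / k) \<odot>\<^bsub>W\<^esub> d0)"
        proof -
          have "fps_const (- 1) = \<ominus>\<^bsub>R\<^esub> (1 :: 'k fps)" using R_minus[OF in_R(2)] by (simp flip: fps_const_neg)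
          then show ?thesis using smult_l_minus[OF in_R(2) ld0c] ld0c by simp
        qed
        ultimately have "d \<in> D" unfolding d1_def using ld0c car(1) by (simp add: M.a_assoc M.r_neg)
        then show False using d by simp
      qed
    qed
    have d1W: "d1 \<in> carrier W - yW" using d1 D by (auto simp: subspace_def)
    have sm: "a \<odot>\<^bsub>W\<^esub> d1 = a \<odot>\<^bsub>W\<^esub> d \<oplus>\<^bsub>W\<^esub> fps_const (l / k) \<odot>\<^bsub>W\<^esub> (a \<odot>\<^bsub>W\<^esub> d0)" if "a \<in> carrier R" for a
      unfolding d1_def using that car ld0c in_R(7) by (simp add: smult_r_distr mult.commute flip: smult_mult)
    obtain h1 where h1: "h1 \<in> T d1" "val d1 = \<rho> h1" "\<And>h'. h' \<in> T d1 \<Longrightarrow> \<rho> h' \<le> \<rho> h1" using val_top[OF d1W] by metis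
    have h1R: "fps_X ^ h1 \<in> carrier R" "h1 \<in> B" using h1(1) B_in_R by (auto simp: T_def)
    have "h1 \<noteq> h"
    proof
      assume "h1 = h"
      have "fps_const (1 / k) \<odot>\<^bsub>W\<^esub> (fps_const k \<odot>\<^bsub>W\<^esub> (fps_X ^ h \<odot>\<^bsub>W\<^esub> d) \<oplus>\<^bsub>W\<^esub> fps_const l \<odot>\<^bsub>W\<^esub> (fps_X ^ h \<odot>\<^bsub>W\<^esub> d0)) \<in> yW"
        using kl(2) in_R(7) yW_closed(3) by blast
      moreover have "fps_const (1 / k) \<odot>\<^bsub>W\<^esub> (fps_const k \<odot>\<^bsub>W\<^esub> (fps_X ^ h \<odot>\<^bsub>W\<^esub> d) \<oplus>\<^bsub>W\<^esub> fps_const l \<odot>\<^bsub>W\<^esub> (fps_X ^ h \<odot>\<^bsub>W\<^esub> d0))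
          = (fps_const (1 / k) * fps_const k) \<odot>\<^bsub>W\<^esub> (fps_X ^ h \<odot>\<^bsub>W\<^esub> d) \<oplus>\<^bsub>W\<^esub> (fps_const (1 / k) * fps_const l) \<odot>\<^bsub>W\<^esub> (fps_X ^ h \<odot>\<^bsub>W\<^esub> d0)"
        using car in_R(7) by (simp add: smult_r_distr smult_mult del: fps_const_mult)
      ultimately have "fps_X ^ h \<odot>\<^bsub>W\<^esub> d1 \<in> yW" using \<open>k \<noteq> 0\<close> sm[OF hB(3)] car by simp
      then show False using h1(1) \<open>h1 = h\<close> by (simp add: T_def)
    qed
    moreover have "\<rho> h1 \<le> \<rho> h"
    proof (rule ccontr)
      assume "\<not> \<rho> h1 \<le> \<rho> h"
      then have "h1 \<notin> T d" "h1 \<notin> T d0" using h(3) h0(3) by auto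
      then have "fps_X ^ h1 \<odot>\<^bsub>W\<^esub> d \<in> yW" "fps_X ^ h1 \<odot>\<^bsub>W\<^esub> d0 \<in> yW" using h1R by (auto simp: T_def)
      then have "fps_X ^ h1 \<odot>\<^bsub>W\<^esub> d1 \<in> yW" unfolding sm[OF h1R(1)] using in_R(7) yW_closed by auto
      then show False using h1(1) by (simp add: T_def)
    qed
    ultimately have "\<rho> h1 < \<rho> h" using \<rho>_inj h1R hB(1) by (metis inj_onD le_neq_implies_less)
    then show False using min[OF d1] h(2) h1(2) by simp
  qed
  moreover have "val d \<in> val ` (D' - yW)" using d dW by auto
  moreover have "val ` (D - yW) \<subseteq> val ` (D' - yW)" using D(3) by auto
  ultimately show ?thesis by blast
qed

lemma subspace_carrier: "subspace (carrier W)"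
  unfolding subspace_def using yW_closed(1) in_R(7) by auto

text \<open>A nonzero map to \<open>R\<close> gives \<open>c + 1\<close> strict steps in a
  filtration of \<open>W / yW\<close>. By \<open>val_strict_mono\<close> each step costs a value of
  \<open>val\<close>, and \<open>B\<close> has \<open>c + 1\<close> elements.\<close>

lemma val_image_carrier:
  assumes f: "f \<in> mod_hom R W (ring_module R)" and nz: "w0 \<in> carrier W" "f w0 \<noteq> 0"
  shows "val ` (carrier W - yW) = \<rho> ` B"
proof -
  have f_R: "f v \<in> carrier R" if "v \<in> carrier W" for v
    using f that by (auto simp: mod_hom_def)
  have f_add: "f (u \<oplus>\<^bsub>W\<^esub> v) = f u + f v" if "u \<in> carrier W" "v \<in> carrier W" for u v
    using f that by (auto simp: mod_hom_def)
  have f_smult: "f (a \<odot>\<^bsub>W\<^esub> v) = a * f v" if "a \<in> carrier R" "v \<in> carrier W" for a v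
    using f that by (auto simp: mod_hom_def)
  \<comment> \<open>This set is stable under adding \<open>c + 1\<close>, through multiplication by
    \<open>y\<close>, and cofinite, through the multiples of \<open>w0\<close>.\<close>
  define \<Gamma> where "\<Gamma> = {subdegree (f v) | v. v \<in> carrier W \<and> f v \<noteq> 0}"
  define G where "G = \<Gamma> - (+) (c + 1) ` \<Gamma>"
  have "card G = c + 1"
    unfolding G_def
  proof (rule card_shift_complement)
    fix g assume "g \<in> \<Gamma>"
    then obtain v where v: "v \<in> carrier W" "f v \<noteq> 0" "g = subdegree (f v)" by (auto simp: \<Gamma>_def)
    have "f (y \<odot>\<^bsub>W\<^esub> v) = y * f v" using f_smult y_in_R v(1) by simp
    then have "subdegree (f (y \<odot>\<^bsub>W\<^esub> v)) = c + 1 + g" "f (y \<odot>\<^bsub>W\<^esub> v) \<noteq> 0"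
      using v(2,3) y_nz by (auto simp: subdegree_y)
    then show "c + 1 + g \<in> \<Gamma>"
      unfolding \<Gamma>_def using v(1) y_in_R by (intro CollectI exI[of _ "y \<odot>\<^bsub>W\<^esub> v"]) auto
  next
    fix n assume n: "n \<ge> subdegree (f w0) + c"
    define h where "h = n - subdegree (f w0)"
    have h: "fps_X ^ h \<in> carrier R" using ge_c[of h] n by (simp add: h_def monom_in_R)
    have "f (fps_X ^ h \<odot>\<^bsub>W\<^esub> w0) = fps_X ^ h * f w0" using f_smult h nz(1) by simp
    then have "subdegree (f (fps_X ^ h \<odot>\<^bsub>W\<^esub> w0)) = n" "f (fps_X ^ h \<odot>\<^bsub>W\<^esub> w0) \<noteq> 0"
      using nz(2) n by (auto simp: h_def fps_X_power_subdegree)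
    then show "n \<in> \<Gamma>"
      unfolding \<Gamma>_def using nz(1) h by (intro CollectI exI[of _ "fps_X ^ h \<odot>\<^bsub>W\<^esub> w0"]) auto
  qed
  \<comment> \<open>The order filtration of the image of \<open>f\<close>, taken modulo
    \<open>y\<close> and pulled back to \<open>W\<close>.\<close>
  define D where "D s = {v \<in> carrier W. \<exists>v'\<in>carrier W. \<forall>i<s. fps_nth (f v - y * f v') i = 0}" for s
  have sub: "subspace (D s)" for s
    unfolding subspace_def
  proof (intro conjI ballI allI subsetI)
    fix v assume "v \<in> yW"
    then obtain v' where v': "v' \<in> carrier W" "v = y \<odot>\<^bsub>W\<^esub> v'" by (auto simp: yW_def)
    then have "f v - y * f v' = 0" using f_smult y_in_R by simp
    then show "v \<in> D s" unfolding D_def using v' y_in_R by auto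
  next
    fix u v assume "u \<in> D s" "v \<in> D s"
    then obtain u' v' where uv: "u \<in> carrier W" "v \<in> carrier W" "u' \<in> carrier W" "v' \<in> carrier W"
      "\<forall>i<s. fps_nth (f u - y * f u') i = 0" "\<forall>i<s. fps_nth (f v - y * f v') i = 0"
      by (auto simp: D_def)
    have "f (u \<oplus>\<^bsub>W\<^esub> v) - y * f (u' \<oplus>\<^bsub>W\<^esub> v') = (f u - y * f u') + (f v - y * f v')"
      using uv(1-4) f_add by (simp add: algebra_simps)
    then have "\<forall>i<s. fps_nth (f (u \<oplus>\<^bsub>W\<^esub> v) - y * f (u' \<oplus>\<^bsub>W\<^esub> v')) i = 0" using uv(5,6) by (simp del: fps_sub_nth)
    then show "u \<oplus>\<^bsub>W\<^esub> v \<in> D s" unfolding D_def using uv(1-4) by auto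
  next
    fix v k assume "v \<in> D s"
    then obtain v' where v: "v \<in> carrier W" "v' \<in> carrier W" "\<forall>i<s. fps_nth (f v - y * f v') i = 0"
      by (auto simp: D_def)
    have "f (fps_const k \<odot>\<^bsub>W\<^esub> v) - y * f (fps_const k \<odot>\<^bsub>W\<^esub> v') = fps_const k * (f v - y * f v')"
      using v(1,2) f_smult in_R(7) by (simp add: algebra_simps)
    then have "\<forall>i<s. fps_nth (f (fps_const k \<odot>\<^bsub>W\<^esub> v) - y * f (fps_const k \<odot>\<^bsub>W\<^esub> v')) i = 0"
      using v(3) by (simp del: fps_sub_nth)
    then show "fps_const k \<odot>\<^bsub>W\<^esub> v \<in> D s" unfolding D_def using v(1,2) in_R(7) by blast
  qed (auto simp: D_def)
  have anti: "D (Suc s) \<subseteq> D s" for s unfolding D_def by (auto simp: less_Suc_eq)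
  have strict: "D (Suc p) \<noteq> D p" if "p \<in> G" for p
  proof -
    obtain v where v: "v \<in> carrier W" "f v \<noteq> 0" "p = subdegree (f v)"
      using \<open>p \<in> G\<close> by (auto simp: G_def \<Gamma>_def)
    have "f \<zero>\<^bsub>W\<^esub> = 0" using f_smult[OF in_R(1) nz(1)] nz(1) by simp
    then have "\<forall>i<p. fps_nth (f v - y * f \<zero>\<^bsub>W\<^esub>) i = 0" using v(3) by auto
    then have "v \<in> D p" unfolding D_def using v(1) by blast
    \<comment> \<open>Agreement up to and including exponent \<open>p\<close> would give
      \<open>y * f v'\<close> the order \<open>p\<close>, making \<open>p\<close> equal to
      \<open>c + 1\<close> plus an element of \<open>\<Gamma>\<close>.\<close>
    moreover have "v \<notin> D (Suc p)"
    proof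
      assume "v \<in> D (Suc p)"
      then obtain v' where v': "v' \<in> carrier W" "\<forall>i<Suc p. fps_nth (f v - y * f v') i = 0" by (auto simp: D_def)
      then have eq: "fps_nth (f v) i = fps_nth (y * f v') i" if "i < Suc p" for i using that by simp
      have "subdegree (y * f v') = p"
      proof (rule subdegreeI)
        show "fps_nth (y * f v') p \<noteq> 0" using eq[of p] v(2,3) by (metis lessI nth_subdegree_nonzero)
        show "fps_nth (y * f v') i = 0" if "i < p" for i using eq[of i] that v(3) by auto
      qed
      moreover have "f v' \<noteq> 0" using eq[of p] v(2,3) by (metis fps_zero_nth lessI mult_zero_right nth_subdegree_nonzero)
      ultimately have "p = c + 1 + subdegree (f v')" using y_nz by (simp add: subdegree_y)
      moreover have "subdegree (f v') \<in> \<Gamma>" using v'(1) \<open>f v' \<noteq> 0\<close> by (auto simp: \<Gamma>_def)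
      ultimately show False using \<open>p \<in> G\<close> by (auto simp: G_def)
    qed
    ultimately show ?thesis by blast
  qed
  have fin: "finite (val ` (D s - yW))" "val ` (D s - yW) \<subseteq> \<rho> ` B" for s
  proof -
    show "val ` (D s - yW) \<subseteq> \<rho> ` B" using val_in by (auto simp: D_def)
    then show "finite (val ` (D s - yW))" using finite_B by (meson finite_imageI finite_subset)
  qed
  have "card G \<le> card (val ` (D 0 - yW))"
  proof (rule card_le_of_strict_descent[where V = "\<lambda>s. val ` (D s - yW)"])
    show "val ` (D (Suc p) - yW) \<noteq> val ` (D p - yW)" if "p \<in> G" for p
    proof -
      have "D (Suc p) \<subset> D p" using anti[of p] strict[OF that] by (rule psubsetI)
      then show ?thesis using val_strict_mono[OF sub sub] by (metis psubset_imp_subset psubsetE subset_refl)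
    qed
    show "val ` (D (Suc s) - yW) \<subseteq> val ` (D s - yW)" for s
      using anti[of s] by (intro image_mono) auto
  qed (rule fin)
  moreover have "card (\<rho> ` B) \<le> c + 1" using card_image_le[OF finite_B] card_B by metis
  ultimately have "val ` (D 0 - yW) = \<rho> ` B"
    using \<open>card G = c + 1\<close> fin(2)[of 0] finite_B by (intro card_seteq) auto
  moreover have "D 0 = carrier W" using nz(1) by (auto simp: D_def)
  ultimately show ?thesis by simp
qed

section \<open>The isomorphism between \<open>CC\<close> and \<open>W\<close>\<close>

definition CC :: "'k fps set" where "CC = {q. \<forall>n. fps_nth q n \<noteq> 0 \<longrightarrow> n \<in> KK}"

lemma CC_add: "p \<in> CC \<Longrightarrow> q \<in> CC \<Longrightarrow> p + q \<in> CC"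
  unfolding CC_def by (auto, metis add_0)

lemma CC_smult: "a \<in> carrier R \<Longrightarrow> q \<in> CC \<Longrightarrow> a * q \<in> CC"
proof -
  assume a: "a \<in> carrier R" and q: "q \<in> CC"
  have "n \<in> KK" if nz: "fps_nth (a * q) n \<noteq> 0" for n
  proof -
    obtain i j where "i \<in> H" "j \<in> KK" "n = i + j"
      using supp_mult[of a H q KK n, OF _ _ nz] a q by (auto simp: carrier_iff CC_def)
    then show ?thesis using KK_add by simp
  qed
  then show ?thesis by (simp add: CC_def)
qed

lemma CC_monom: "fps_X ^ k \<in> CC \<longleftrightarrow> k \<in> KK"
  by (auto simp: CC_def fps_X_power_nth)

lemma y_CC: "q \<in> CC \<Longrightarrow> y * q \<in> carrier R"
  by (rule high_in_R) (simp add: y_def fps_X_power_mult_nth del: power_Suc power_add)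

text \<open>\<open>CC\<close> is isomorphic to \<open>W\<close> and contains 1; the inverse
  isomorphism followed by multiplication by \<open>fps_X ^ n\<close> is a map to \<open>R\<close>
  with \<open>fps_X ^ n\<close> in its image.\<close>

lemma monom_in_trace:
  assumes fg: "fin_gen R W"
    and f: "f \<in> mod_hom R W (ring_module R)" "w0 \<in> carrier W" "f w0 \<noteq> 0"
    and n: "\<And>k. k \<in> KK \<Longrightarrow> n + k \<in> H"
  shows "fps_X ^ n \<in> module_trace R W"
proof -
  \<comment> \<open>The element \<open>w\<close> found here plays the role of 1 in
    \<open>CC\<close>: in the order given by \<open>\<rho>\<close>, \<open>fps_X ^ (2 * c)\<close>
    is the last monomial from \<open>B\<close> not sending it into \<open>yW\<close>.\<close>
  have "\<rho> (2 * c) \<in> val ` (carrier W - yW)"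
    using val_image_carrier[OF f] two_c_in_B by simp
  then obtain w where w: "w \<in> carrier W - yW" "val w = \<rho> (2 * c)" by auto
  then have wc: "w \<in> carrier W" by simp
  obtain h where h: "h \<in> T w" "val w = \<rho> h" "\<And>h'. h' \<in> T w \<Longrightarrow> \<rho> h' \<le> \<rho> h" using val_top[OF w(1)] by metis
  then have "h = 2 * c" using w(2) \<rho>_inj two_c_in_B by (auto simp: T_def inj_on_def)
  note h = h[unfolded this]
  have w1: "fps_X ^ (2 * c) \<odot>\<^bsub>W\<^esub> w \<notin> yW" using h(1) by (simp add: T_def)
  have w_nz: "w \<noteq> \<zero>\<^bsub>W\<^esub>" using w(1) submodule_zero[OF submodule_yW] by auto
  have w2: "fps_X ^ (c + 1 + k) \<odot>\<^bsub>W\<^esub> w \<in> yW" if "k \<in> KK" for k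
  proof (cases "c + 1 + k \<in> B")
    case True
    have "2 * c \<notin> (+) (c + 1) ` KK"
    proof
      assume "2 * c \<in> (+) (c + 1) ` KK"
      then obtain k where "2 * c = c + 1 + k" "k \<in> KK" by auto
      then show False by (auto simp: KK_def)
    qed
    then have "\<rho> (2 * c) = 2 * c + (2 * c + 1)" by (simp add: \<rho>_def)
    moreover have "\<rho> (c + 1 + k) = c + 1 + k + (2 * c + 1) * 2" using that by (simp add: \<rho>_def)
    ultimately have "\<rho> (2 * c) < \<rho> (c + 1 + k)" by simp
    then have "c + 1 + k \<notin> T w" using h(3)[of "c + 1 + k"] by auto
    then show ?thesis using True by (auto simp: T_def)
  next
    case False
    then show ?thesis using monom_notin_B[OF ge_c False wc] by simp
  qed
  \<comment> \<open>Since \<open>y * q\<close> sends \<open>w\<close> into \<open>yW\<close>,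
    division by \<open>y\<close> gives a meaning to \<open>q\<close> times \<open>w\<close>,
    although \<open>q\<close> need not lie in \<open>R\<close>.\<close>
  have ex: "\<exists>v. v \<in> carrier W \<and> y \<odot>\<^bsub>W\<^esub> v = (y * q) \<odot>\<^bsub>W\<^esub> w" if q: "q \<in> CC" for q
  proof -
    have "(y * q) \<odot>\<^bsub>W\<^esub> w \<in> yW"
    proof (rule smult_in_yW[OF wc y_CC[OF q]])
      fix n assume "fps_nth (y * q) n \<noteq> 0"
      then have "n \<ge> c + 1" "fps_nth q (n - (c + 1)) \<noteq> 0"
        by (auto simp: y_def fps_X_power_mult_nth simp del: power_Suc power_add split: if_splits)
      then have "n - (c + 1) \<in> KK" "n = c + 1 + (n - (c + 1))" using q by (auto simp: CC_def)
      then show "fps_X ^ n \<odot>\<^bsub>W\<^esub> w \<in> yW" using w2 by metis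
    qed
    then show ?thesis by (auto simp: yW_def)
  qed
  define \<phi> where "\<phi> q = (SOME v. v \<in> carrier W \<and> y \<odot>\<^bsub>W\<^esub> v = (y * q) \<odot>\<^bsub>W\<^esub> w)" for q
  have \<phi>: "\<phi> q \<in> carrier W" "y \<odot>\<^bsub>W\<^esub> \<phi> q = (y * q) \<odot>\<^bsub>W\<^esub> w" if "q \<in> CC" for q
    using someI_ex[OF ex[OF that]] by (auto simp: \<phi>_def)
  note cancel = smult_cancel[OF y_in_R y_nz]
  have \<phi>_add: "\<phi> (p + q) = \<phi> p \<oplus>\<^bsub>W\<^esub> \<phi> q" if "p \<in> CC" "q \<in> CC" for p q
  proof (rule cancel)
    show "y \<odot>\<^bsub>W\<^esub> \<phi> (p + q) = y \<odot>\<^bsub>W\<^esub> (\<phi> p \<oplus>\<^bsub>W\<^esub> \<phi> q)"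
      using that \<phi> CC_add y_CC y_in_R wc by (simp add: smult_r_distr distrib_left smult_add)
  qed (use that \<phi> CC_add in auto)
  have \<phi>_smult: "\<phi> (a * q) = a \<odot>\<^bsub>W\<^esub> \<phi> q" if "a \<in> carrier R" "q \<in> CC" for a q
  proof (rule cancel)
    have "y \<odot>\<^bsub>W\<^esub> (a \<odot>\<^bsub>W\<^esub> \<phi> q) = a \<odot>\<^bsub>W\<^esub> (y \<odot>\<^bsub>W\<^esub> \<phi> q)"
      using that \<phi>(1) y_in_R by (simp add: mult.commute flip: smult_mult)
    also have "\<dots> = (a * (y * q)) \<odot>\<^bsub>W\<^esub> w" using that \<phi>(2) y_CC wc by (simp add: smult_mult)
    also have "a * (y * q) = y * (a * q)" by (simp add: ac_simps)
    also have "(y * (a * q)) \<odot>\<^bsub>W\<^esub> w = y \<odot>\<^bsub>W\<^esub> \<phi> (a * q)" using \<phi>(2)[OF CC_smult[OF that]] by simp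
    finally show "y \<odot>\<^bsub>W\<^esub> \<phi> (a * q) = y \<odot>\<^bsub>W\<^esub> (a \<odot>\<^bsub>W\<^esub> \<phi> q)" by simp
  qed (use that \<phi> CC_smult in auto)
  have \<phi>_yW: "\<phi> (y * q) \<in> yW" if "q \<in> CC" for q
    using that \<phi>_smult[OF y_in_R that] \<phi>(1) yW_closed(4) by simp
  have neg: "- q \<in> CC" if "q \<in> CC" for q using that by (auto simp: CC_def)
  have zero: "0 \<in> CC" by (simp add: CC_def)
  have \<phi>_0: "\<phi> 0 = \<zero>\<^bsub>W\<^esub>" using \<phi>_smult[OF in_R(1) zero] \<phi>(1)[OF zero] by simp
  have inj: "p = q" if pq: "p \<in> CC" "q \<in> CC" "\<phi> p = \<phi> q" for p q
  proof -
    have "- 1 * q = - q" by simp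
    then have "\<phi> (p + - 1 * q) = \<phi> p \<oplus>\<^bsub>W\<^esub> (- 1) \<odot>\<^bsub>W\<^esub> \<phi> q"
      using pq \<phi>_add \<phi>_smult[OF in_R(5)[OF in_R(2)]] neg by metis
    also have "\<dots> = \<phi> (q + - 1 * q)"
      using pq \<phi>_add \<phi>_smult[OF in_R(5)[OF in_R(2)]] neg \<open>- 1 * q = - q\<close> by metis
    finally have "\<phi> (p - q) = \<zero>\<^bsub>W\<^esub>" using \<phi>_0 by simp
    moreover have pqC: "p - q \<in> CC" using CC_add[OF pq(1) neg[OF pq(2)]] by simp
    ultimately have "(y * (p - q)) \<odot>\<^bsub>W\<^esub> w = \<zero>\<^bsub>W\<^esub>" using \<phi>(2)[OF pqC] y_in_R by simp
    then have "y * (p - q) = 0" using torsion_free[OF y_CC[OF pqC] wc] w_nz by simp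
    then show ?thesis using y_nz by simp
  qed
  define X where "X = \<phi> ` CC"
  have X: "submodule X R W"
  proof (rule submoduleI)
    show "X \<subseteq> carrier W" using \<phi>(1) by (auto simp: X_def)
    show "\<zero>\<^bsub>W\<^esub> \<in> X" using \<phi>_0 zero by (metis X_def imageI)
  next
    fix u assume "u \<in> X"
    then obtain q where q: "q \<in> CC" "u = \<phi> q" by (auto simp: X_def)
    have "\<phi> (- q) \<oplus>\<^bsub>W\<^esub> u = \<zero>\<^bsub>W\<^esub>" using \<phi>_add[OF neg[OF q(1)] q(1)] \<phi>_0 q by simp
    then have "\<ominus>\<^bsub>W\<^esub> u = \<phi> (- q)" using \<phi>(1) neg q by (intro M.minus_equality) auto
    then show "\<ominus>\<^bsub>W\<^esub> u \<in> X" using neg[OF q(1)] by (auto simp: X_def)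
  next
    fix u v assume "u \<in> X" "v \<in> X"
    then show "u \<oplus>\<^bsub>W\<^esub> v \<in> X" unfolding X_def using \<phi>_add CC_add by (auto, metis imageI)
  next
    fix a v assume "a \<in> carrier R" "v \<in> X"
    then show "a \<odot>\<^bsub>W\<^esub> v \<in> X" unfolding X_def using \<phi>_smult CC_smult by (auto, metis imageI)
  qed
  note XW = subsetD[OF submoduleE(1)[OF X]]
  \<comment> \<open>\<open>X + yW\<close> stands for the image of \<open>CC\<close> in
    \<open>W / yW\<close>; that it is everything follows by counting values of
    \<open>val\<close>.\<close>
  define D where "D = {u \<oplus>\<^bsub>W\<^esub> v | u v. u \<in> X \<and> v \<in> yW}"
  have D_sub: "subspace D"
    unfolding subspace_def
  proof (intro conjI ballI allI subsetI)
    fix v assume "v \<in> D"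
    then show "v \<in> carrier W" using XW yW_closed(1) by (auto simp: D_def)
  next
    fix v assume "v \<in> yW"
    then show "v \<in> D" unfolding D_def
      using submodule_zero[OF X] yW_closed(1) by (intro CollectI exI[of _ "\<zero>\<^bsub>W\<^esub>"] exI[of _ v]) auto
  next
    fix u v assume "u \<in> D" "v \<in> D"
    then obtain u1 u2 v1 v2 where uv: "u = u1 \<oplus>\<^bsub>W\<^esub> u2" "v = v1 \<oplus>\<^bsub>W\<^esub> v2" "u1 \<in> X" "u2 \<in> yW" "v1 \<in> X" "v2 \<in> yW"
      by (auto simp: D_def)
    have "u \<oplus>\<^bsub>W\<^esub> v = (u1 \<oplus>\<^bsub>W\<^esub> v1) \<oplus>\<^bsub>W\<^esub> (u2 \<oplus>\<^bsub>W\<^esub> v2)" using uv XW yW_closed(1) by (simp add: M.a_ac)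
    then show "u \<oplus>\<^bsub>W\<^esub> v \<in> D" unfolding D_def using uv submoduleE(5)[OF X] yW_closed(2) by blast
  next
    fix v k assume "v \<in> D"
    then obtain v1 v2 where v: "v = v1 \<oplus>\<^bsub>W\<^esub> v2" "v1 \<in> X" "v2 \<in> yW" by (auto simp: D_def)
    have "fps_const k \<odot>\<^bsub>W\<^esub> v = fps_const k \<odot>\<^bsub>W\<^esub> v1 \<oplus>\<^bsub>W\<^esub> fps_const k \<odot>\<^bsub>W\<^esub> v2"
      using v XW yW_closed(1) in_R(7) by (simp add: smult_r_distr)
    then show "fps_const k \<odot>\<^bsub>W\<^esub> v \<in> D"
      unfolding D_def using v submoduleE(4)[OF X] yW_closed(3) in_R(7) by blast
  qed
  have "\<rho> ` B \<subseteq> val ` (D - yW)"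
  proof
    fix r assume "r \<in> \<rho> ` B"
    then obtain h' where h': "h' \<in> B" "r = \<rho> h'" by auto
    \<comment> \<open>The complementary exponent: since \<open>h' + k = 2 * c\<close>,
      \<open>fps_X ^ h'\<close> takes \<open>\<phi> (fps_X ^ k)\<close> to
      \<open>fps_X ^ (2 * c)\<close> times \<open>w\<close>, which is outside
      \<open>yW\<close>.\<close>
    define k where "k = 2 * c - h'"
    have h'_le: "h' \<le> 2 * c" using B_le h' by simp
    have "k \<in> KK"
    proof (rule ccontr)
      assume "k \<notin> KK"
      then have "k < c" "c - 1 - k \<in> H" by (auto simp: notin_KK)
      moreover have "h' = c + 1 + (c - 1 - k)" using \<open>k < c\<close> h'_le by (simp add: k_def)
      ultimately show False using h'(1) unfolding B_def by blast
    qed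
    then have kC: "fps_X ^ k \<in> CC" by (simp add: CC_monom)
    define v where "v = \<phi> (fps_X ^ k)"
    have vW: "v \<in> carrier W" using \<phi>(1) kC by (simp add: v_def)
    have eq: "fps_X ^ h \<odot>\<^bsub>W\<^esub> v = \<phi> (fps_X ^ (h + k))" if "h \<in> B" for h
      using \<phi>_smult[OF B_in_R[OF that] kC] by (simp add: v_def power_add)
    have "fps_X ^ h' \<odot>\<^bsub>W\<^esub> v = fps_X ^ (2 * c) \<odot>\<^bsub>W\<^esub> w"
    proof (rule cancel)
      have C: "fps_X ^ (h' + k) \<in> CC" using CC_smult[OF B_in_R[OF h'(1)] kC] by (simp add: power_add)
      have "h' + k = 2 * c" using h'_le by (simp add: k_def)
      then show "y \<odot>\<^bsub>W\<^esub> (fps_X ^ h' \<odot>\<^bsub>W\<^esub> v) = y \<odot>\<^bsub>W\<^esub> (fps_X ^ (2 * c) \<odot>\<^bsub>W\<^esub> w)"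
        using eq[OF h'(1)] \<phi>(2)[OF C] y_in_R wc B_in_R[OF two_c_in_B] by (simp add: smult_mult)
    qed (use vW wc B_in_R h'(1) two_c_in_B in auto)
    then have T: "h' \<in> T v" using w1 h'(1) by (simp add: T_def)
    have max: "\<rho> h \<le> \<rho> h'" if "h \<in> T v" for h
    proof -
      have hB: "h \<in> B" "fps_X ^ h \<odot>\<^bsub>W\<^esub> v \<notin> yW" using that by (auto simp: T_def)
      \<comment> \<open>If \<open>h + k\<close> reaches \<open>c + 1\<close>, its excess must lie
        outside \<open>KK\<close>, and duality puts \<open>2 * c - (h + k)\<close> in
        \<open>H\<close>. So \<open>h'\<close> exceeds \<open>h\<close> by an element of
        \<open>H\<close>.\<close>
      have "h + k \<le> 2 * c \<and> 2 * c - (h + k) \<in> H"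
      proof (cases "h + k \<ge> c + 1")
        case True
        define l where "l = h + k - (c + 1)"
        have hk: "h + k = c + 1 + l" using True by (simp add: l_def)
        have "l \<notin> KK"
        proof
          assume "l \<in> KK"
          then have "\<phi> (y * fps_X ^ l) \<in> yW" using \<phi>_yW CC_monom by blast
          moreover have "y * fps_X ^ l = fps_X ^ (h + k)" unfolding y_def hk by (rule power_add[symmetric])
          ultimately show False using hB eq by simp
        qed
        then have "l < c" "c - 1 - l \<in> H" by (auto simp: notin_KK)
        moreover have "2 * c - (h + k) = c - 1 - l" using hk by simp
        ultimately show ?thesis using hk by simp
      next
        case False
        then show ?thesis by (auto intro: ge_c)
      qed
      moreover have "2 * c - (h + k) = h' - h" using h'_le by (simp add: k_def)
      ultimately have le: "h \<le> h'" "h' - h \<in> H" using h'_le by (auto simp: k_def)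
      show ?thesis
      proof (cases "h = h'")
        case False
        then show ?thesis using \<rho>_less[OF le(2), of h] le(1) by simp
      qed simp
    qed
    have "val v = \<rho> h'" using T max by (rule val_eqI)
    moreover have "v \<in> D" unfolding D_def X_def v_def
      using kC submodule_zero[OF submodule_yW] \<phi>(1)
      by (intro CollectI exI[of _ "\<phi> (fps_X ^ k)"] exI[of _ "\<zero>\<^bsub>W\<^esub>"]) auto
    moreover have "v \<notin> yW" using T yW_closed(3)[OF B_in_R[OF h'(1)]] by (auto simp: T_def)
    ultimately show "r \<in> val ` (D - yW)" using h'(2) by (metis DiffI imageI)
  qed
  moreover have "val ` (carrier W - yW) \<subseteq> \<rho> ` B" using val_in by auto
  ultimately have "\<not> val ` (D - yW) \<subset> val ` (carrier W - yW)" by (metis leD order_trans)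
  then have "\<not> D \<subset> carrier W" by (rule contrapos_nn) (rule val_strict_mono[OF D_sub subspace_carrier])
  then have DW: "D = carrier W" using D_sub by (auto simp: subspace_def)
  obtain G where G: "finite G" "G \<subseteq> carrier W" "submodule_span R W G = carrier W"
    using fg by (auto simp: fin_gen_def)
  have XG: "X \<union> G \<subseteq> carrier W" using G(2) XW by auto
  \<comment> \<open>\<open>X + yW\<close> is all of \<open>W\<close>, and Nakayama removes
    \<open>yW\<close>.\<close>
  have "X = carrier W"
  proof (rule nakayama[OF y_in_R _ X G(1,2)])
    fix b assume b: "b \<in> carrier R"
    then have "1 - y * b \<in> Units R" unfolding Units_iff using y_max in_R y_in_R by (simp add: max_ideal_iff)
    moreover have "\<one>\<^bsub>R\<^esub> \<ominus>\<^bsub>R\<^esub> y \<otimes>\<^bsub>R\<^esub> b = 1 - y * b" using b y_in_R in_R(3) by (simp add: a_minus_def)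
    ultimately show "\<one>\<^bsub>R\<^esub> \<ominus>\<^bsub>R\<^esub> y \<otimes>\<^bsub>R\<^esub> b \<in> Units R" by simp
  next
    have "submodule_span R W G \<subseteq> submodule_span R W (X \<union> G)"
      using submodule_span[OF XG] by (intro submodule_span_minimal) auto
    then show "submodule_span R W (X \<union> G) = carrier W"
      using G(3) submodule_span_minimal[OF carrier_is_submodule XG] by auto
  next
    fix v assume "v \<in> carrier W"
    then have "v \<in> D" by (simp only: DW)
    then show "\<exists>u\<in>X. \<exists>v'\<in>carrier W. v = u \<oplus>\<^bsub>W\<^esub> y \<odot>\<^bsub>W\<^esub> v'" by (auto simp: D_def yW_def)
  qed
  then have surj: "\<phi> ` CC = carrier W" by (simp add: X_def)
  define \<psi> where "\<psi> v = inv_into CC \<phi> v" for v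
  have inj_on: "inj_on \<phi> CC" using inj by (rule inj_onI)
  have \<psi>: "\<psi> v \<in> CC" "\<phi> (\<psi> v) = v" if "v \<in> carrier W" for v
    using that surj inv_into_into[of v \<phi> CC] f_inv_into_f[of v \<phi> CC] by (auto simp: \<psi>_def)
  have \<psi>_eq: "\<psi> (\<phi> q) = q" if "q \<in> CC" for q using that inj_on by (simp add: \<psi>_def)
  have mult_R: "fps_X ^ n * q \<in> carrier R" if "q \<in> CC" for q
  proof -
    have "i \<in> H" if "fps_nth (fps_X ^ n * q) i \<noteq> 0" for i
    proof -
      have "n \<le> i" "fps_nth q (i - n) \<noteq> 0" using that by (auto simp: fps_X_power_mult_nth split: if_splits)
      then have "i - n \<in> KK" using \<open>q \<in> CC\<close> by (simp add: CC_def)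
      then have "n + (i - n) \<in> H" by (rule n)
      then show ?thesis using \<open>n \<le> i\<close> by simp
    qed
    then show ?thesis by (simp add: carrier_iff)
  qed
  have hom: "(\<lambda>v. fps_X ^ n * \<psi> v) \<in> mod_hom R W (ring_module R)"
    unfolding mod_hom_def
  proof (intro CollectI conjI ballI)
    show "(\<lambda>v. fps_X ^ n * \<psi> v) ` carrier W \<subseteq> carrier (ring_module R)" using \<psi>(1) mult_R by auto
  next
    fix u v assume uv: "u \<in> carrier W" "v \<in> carrier W"
    then have "\<psi> (u \<oplus>\<^bsub>W\<^esub> v) = \<psi> u + \<psi> v" using \<psi>_eq \<phi>_add \<psi> CC_add by metis
    then show "fps_X ^ n * \<psi> (u \<oplus>\<^bsub>W\<^esub> v) = fps_X ^ n * \<psi> u \<oplus>\<^bsub>ring_module R\<^esub> fps_X ^ n * \<psi> v"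
      by (simp add: distrib_left)
  next
    fix a v assume av: "a \<in> carrier R" "v \<in> carrier W"
    then have "\<psi> (a \<odot>\<^bsub>W\<^esub> v) = a * \<psi> v" using \<psi>_eq \<phi>_smult \<psi> CC_smult by metis
    then show "fps_X ^ n * \<psi> (a \<odot>\<^bsub>W\<^esub> v) = a \<odot>\<^bsub>ring_module R\<^esub> (fps_X ^ n * \<psi> v)" by (simp add: ac_simps)
  qed
  have one: "1 \<in> CC" using CC_monom[of 0] zero_in_KK by simp
  have "fps_X ^ n * \<psi> (\<phi> 1) = fps_X ^ n" using \<psi>_eq[OF one] by simp
  then have "fps_X ^ n \<in> (\<Union>f\<in>mod_hom R W (ring_module R). f ` carrier W)"
    using hom \<phi>(1)[OF one] by (metis (no_types, lifting) UN_iff image_eqI)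
  moreover have "(\<Union>f\<in>mod_hom R W (ring_module R). f ` carrier W) \<subseteq> carrier R"
    by (auto simp: mod_hom_def)
  ultimately show ?thesis unfolding module_trace_def using genideal_self by blast
qed

end

context numerical_semigroup_ring
begin

section \<open>The trace of the canonical module\<close>

text \<open>The type is computed with one unknown regular element \<open>x\<close>; the socles modulo \<open>x\<close> and modulo \<open>z\<close> are
  identified through \<open>x u = z s\<close>.\<close>

lemma type_one_module_of_canonical:
  fixes W :: "('k fps, 'm) module"
  assumes W: "maximal_CM_module R W" "cm_type R W = 1"
  shows "type_one_module H R W"
proof -
  have mod: "Module.module R W" using W(1) by (simp add: maximal_CM_module_def)
  interpret W: plain_module R W by (rule plain_module.intro[OF mod])
  have "module_depth R W = 1" using W(1) krull_dim_eq by (simp add: maximal_CM_module_def)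
  then have "1 \<in> {enat (length xs) | xs. regular_seq R W xs}"
    unfolding module_depth_def by (rule enat_Sup_eq_1)
  then have ex: "\<exists>xs. regular_seq R W xs \<and> enat (length xs) = module_depth R W"
    using \<open>module_depth R W = 1\<close> by auto
  define xs where "xs = (SOME xs. regular_seq R W xs \<and> enat (length xs) = module_depth R W)"
  have "regular_seq R W xs" "enat (length xs) = module_depth R W"
    using someI_ex[OF ex] by (auto simp: xs_def)
  then have xs: "regular_seq R W xs" "length xs = 1"
    using \<open>module_depth R W = 1\<close> by (auto simp: one_enat_def)
  then obtain x where x1: "xs = [x]" by (cases xs) auto
  have x: "x \<in> max_ideal R" "x \<in> carrier R" using xs(1) by (auto simp: x1 regular_seq_def max_ideal_iff)
  have x_reg: "v = \<zero>\<^bsub>W\<^esub>" if "v \<in> carrier W" "x \<odot>\<^bsub>W\<^esub> v = \<zero>\<^bsub>W\<^esub>" for v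
    using xs(1) that by (auto simp: x1 regular_seq_def W.seq_mult_Nil)
  have sm: "(a * b) \<odot>\<^bsub>W\<^esub> v = a \<odot>\<^bsub>W\<^esub> (b \<odot>\<^bsub>W\<^esub> v)" if "a \<in> carrier R" "b \<in> carrier R" "v \<in> carrier W" for a b v
    using W.smult_assoc1[of a b v] that by simp
  \<comment> \<open>Regularity of 0 would force \<open>W = 0\<close>, which the properness condition
    in \<open>regular_seq\<close> excludes.\<close>
  have x_nz: "x \<noteq> 0"
  proof
    assume "x = 0"
    then have "v = \<zero>\<^bsub>W\<^esub>" if "v \<in> carrier W" for v using x_reg[OF that] W.smult_l_null[OF that] by simp
    then have "carrier W = {\<zero>\<^bsub>W\<^esub>}" using W.M.zero_closed by blast
    moreover have "\<zero>\<^bsub>W\<^esub> \<in> seq_mult R W xs"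
      unfolding x1 W.seq_mult_single[OF x(2)] using x(2) by (intro image_eqI[of _ _ "\<zero>\<^bsub>W\<^esub>"]) auto
    moreover have "seq_mult R W xs \<subseteq> carrier W" unfolding x1 W.seq_mult_single[OF x(2)] using x(2) by auto
    ultimately have "seq_mult R W xs = carrier W" by auto
    then show False using xs(1) by (simp add: regular_seq_def)
  qed
  \<comment> \<open>A power of \<open>x\<close> is a multiple of \<open>a\<close>, so an element
    killed by \<open>a\<close> is killed by a power of the regular element \<open>x\<close>.\<close>
  have tf: "a = 0 \<or> v = \<zero>\<^bsub>W\<^esub>" if a: "a \<in> carrier R" and v: "v \<in> carrier W" and av: "a \<odot>\<^bsub>W\<^esub> v = \<zero>\<^bsub>W\<^esub>" for a v
  proof (cases "a = 0")
    case False
    then obtain q k where q: "q \<in> carrier R" "k > 0" "x ^ k = a * q" using power_in_multiples[OF _ x(1)] by blast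
    have "(x ^ k) \<odot>\<^bsub>W\<^esub> v = q \<odot>\<^bsub>W\<^esub> (a \<odot>\<^bsub>W\<^esub> v)" unfolding q(3) using a q v by (simp add: sm mult.commute flip: sm)
    then have "(x ^ k) \<odot>\<^bsub>W\<^esub> v = \<zero>\<^bsub>W\<^esub>" using av q(1) by simp
    then have "v = \<zero>\<^bsub>W\<^esub>"
    proof (induction k)
      case 0
      then show ?case using W.smult_one[OF v] by simp
    next
      case (Suc k)
      have "x \<odot>\<^bsub>W\<^esub> (x ^ k \<odot>\<^bsub>W\<^esub> v) = \<zero>\<^bsub>W\<^esub>" using Suc.prems sm[OF x(2) in_R(8)[OF x(2)] v] by simp
      then show ?case using Suc.IH x_reg[of "x ^ k \<odot>\<^bsub>W\<^esub> v"] v in_R(8)[OF x(2)] by auto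
    qed
    then show ?thesis ..
  qed simp
  have cancel: "u = v" if "a \<in> carrier R" "a \<noteq> 0" "u \<in> carrier W" "v \<in> carrier W" "a \<odot>\<^bsub>W\<^esub> u = a \<odot>\<^bsub>W\<^esub> v" for a u v
  proof -
    have "a \<odot>\<^bsub>W\<^esub> (u \<oplus>\<^bsub>W\<^esub> \<ominus>\<^bsub>W\<^esub> v) = \<zero>\<^bsub>W\<^esub>"
      using that by (simp add: W.smult_r_distr W.smult_r_minus W.M.r_neg)
    then have "u \<oplus>\<^bsub>W\<^esub> \<ominus>\<^bsub>W\<^esub> v = \<zero>\<^bsub>W\<^esub>" using tf[OF that(1), of "u \<oplus>\<^bsub>W\<^esub> \<ominus>\<^bsub>W\<^esub> v"] that by auto
    then have "\<ominus>\<^bsub>W\<^esub> (\<ominus>\<^bsub>W\<^esub> v) = u" using that by (intro W.M.minus_equality) auto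
    then show ?thesis using that by simp
  qed
  define xW where "xW = (\<lambda>v. x \<odot>\<^bsub>W\<^esub> v) ` carrier W"
  have xW: "submodule xW R W" unfolding xW_def by (rule W.submodule_smult_image[OF x(2)])
  note xWE = W.submoduleE[OF xW]
  define S where "S = {v \<in> carrier W. \<forall>a\<in>max_ideal R. a \<odot>\<^bsub>W\<^esub> v \<in> xW}"
  have len: "quot_length R W xW S = 1"
    using W(2) unfolding cm_type_def Let_def xs_def[symmetric] x1 W.seq_mult_single[OF x(2)] S_def xW_def .
  have xW_S: "xW \<subseteq> S" using xWE(1,4) by (auto simp: S_def max_ideal_iff)
  \<comment> \<open>Adjoining a socle element takes only scalar coefficients: the part of a
    coefficient in the maximal ideal sends \<open>u\<close> into \<open>xW\<close>, hence into
    \<open>Y\<close>.\<close>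
  have step: "submodule {fps_const k \<odot>\<^bsub>W\<^esub> u \<oplus>\<^bsub>W\<^esub> s | k s. s \<in> Y} R W \<and> Y \<subseteq> {fps_const k \<odot>\<^bsub>W\<^esub> u \<oplus>\<^bsub>W\<^esub> s | k s. s \<in> Y}
      \<and> {fps_const k \<odot>\<^bsub>W\<^esub> u \<oplus>\<^bsub>W\<^esub> s | k s. s \<in> Y} \<subseteq> S \<and> u \<in> {fps_const k \<odot>\<^bsub>W\<^esub> u \<oplus>\<^bsub>W\<^esub> s | k s. s \<in> Y}"
    (is "submodule ?Z R W \<and> _") if Y: "submodule Y R W" "xW \<subseteq> Y" "Y \<subseteq> S" and u: "u \<in> S" for Y u
  proof -
    note YE = W.submoduleE[OF Y(1)]
    have uW: "u \<in> carrier W" using u by (simp add: S_def)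
    have "{b \<odot>\<^bsub>W\<^esub> u \<oplus>\<^bsub>W\<^esub> s | b s. b \<in> carrier R \<and> s \<in> Y} = ?Z"
    proof (intro equalityI subsetI)
      fix v assume "v \<in> {b \<odot>\<^bsub>W\<^esub> u \<oplus>\<^bsub>W\<^esub> s | b s. b \<in> carrier R \<and> s \<in> Y}"
      then obtain b s where b: "v = b \<odot>\<^bsub>W\<^esub> u \<oplus>\<^bsub>W\<^esub> s" "b \<in> carrier R" "s \<in> Y" by auto
      define b' where "b' = b - fps_const (fps_nth b 0)"
      have b': "b' \<in> max_ideal R" "b' \<in> carrier R" using b(2) in_R by (auto simp: b'_def max_ideal_iff)
      then have b'u: "b' \<odot>\<^bsub>W\<^esub> u \<in> Y" using u Y(2) by (auto simp: S_def)
      have "b \<odot>\<^bsub>W\<^esub> u = (fps_const (fps_nth b 0) + b') \<odot>\<^bsub>W\<^esub> u" by (simp add: b'_def)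
      also have "\<dots> = fps_const (fps_nth b 0) \<odot>\<^bsub>W\<^esub> u \<oplus>\<^bsub>W\<^esub> b' \<odot>\<^bsub>W\<^esub> u"
        using W.smult_l_distr[OF in_R(7) b'(2) uW] by simp
      finally have "v = fps_const (fps_nth b 0) \<odot>\<^bsub>W\<^esub> u \<oplus>\<^bsub>W\<^esub> (b' \<odot>\<^bsub>W\<^esub> u \<oplus>\<^bsub>W\<^esub> s)"
        using b b'(2) uW YE(1) in_R(7) by (auto simp: W.M.a_assoc)
      then show "v \<in> ?Z" using YE(5)[OF b'u b(3)] by blast
    qed (use in_R(7) in blast)
    then have Z: "submodule ?Z R W" using W.submodule_sum_single[OF Y(1) uW] by simp
    have sub: "Y \<subseteq> ?Z"
    proof
      fix s assume "s \<in> Y"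
      then show "s \<in> ?Z" using YE(1) uW W.smult_l_null[OF uW]
        by (intro CollectI exI[of _ 0] exI[of _ s]) auto
    qed
    have "v \<in> S" if v: "v \<in> ?Z" for v
    proof -
      obtain k s where ks: "v = fps_const k \<odot>\<^bsub>W\<^esub> u \<oplus>\<^bsub>W\<^esub> s" "s \<in> Y" using v by auto
      have sW: "s \<in> carrier W" using ks(2) YE(1) by auto
      have "a \<odot>\<^bsub>W\<^esub> v \<in> xW" if a: "a \<in> max_ideal R" for a
      proof -
        have aR: "a \<in> carrier R" using a by (simp add: max_ideal_iff)
        have "a \<odot>\<^bsub>W\<^esub> v = fps_const k \<odot>\<^bsub>W\<^esub> (a \<odot>\<^bsub>W\<^esub> u) \<oplus>\<^bsub>W\<^esub> a \<odot>\<^bsub>W\<^esub> s"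
          unfolding ks(1) using aR uW sW in_R(7) by (simp add: W.smult_r_distr mult.commute flip: sm)
        moreover have "a \<odot>\<^bsub>W\<^esub> u \<in> xW" "a \<odot>\<^bsub>W\<^esub> s \<in> xW" using a u ks(2) Y(3) by (auto simp: S_def)
        ultimately show ?thesis using xWE(4,5) in_R(7) by simp
      qed
      then show ?thesis using ks uW sW in_R(7) by (simp add: S_def)
    qed
    moreover have "u \<in> ?Z" using W.submodule_zero[OF Y(1)] uW W.smult_one[OF uW]
      by (intro CollectI exI[of _ 1] exI[of _ "\<zero>\<^bsub>W\<^esub>"]) auto
    ultimately show ?thesis using Z sub by blast
  qed
  \<comment> \<open>Two independent socle elements would give a chain \<open>xW\<close>,
    \<open>Y\<close>, \<open>Z\<close> with two strict steps, against length 1.\<close>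
  have soc_x: "\<exists>k l. (k \<noteq> 0 \<or> l \<noteq> 0) \<and> fps_const k \<odot>\<^bsub>W\<^esub> u \<oplus>\<^bsub>W\<^esub> fps_const l \<odot>\<^bsub>W\<^esub> v \<in> xW"
    if u: "u \<in> S" and v: "v \<in> S" for u v
  proof (rule ccontr)
    assume no: "\<nexists>k l. (k \<noteq> 0 \<or> l \<noteq> 0) \<and> fps_const k \<odot>\<^bsub>W\<^esub> u \<oplus>\<^bsub>W\<^esub> fps_const l \<odot>\<^bsub>W\<^esub> v \<in> xW"
    have uW: "u \<in> carrier W" "v \<in> carrier W" using u v by (auto simp: S_def)
    define Y where "Y = {fps_const k \<odot>\<^bsub>W\<^esub> u \<oplus>\<^bsub>W\<^esub> s | k s. s \<in> xW}"
    have Y: "submodule Y R W" "xW \<subseteq> Y" "Y \<subseteq> S" "u \<in> Y" using step[OF xW subset_refl xW_S u] by (auto simp: Y_def)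
    define Z where "Z = {fps_const k \<odot>\<^bsub>W\<^esub> v \<oplus>\<^bsub>W\<^esub> s | k s. s \<in> Y}"
    have Z: "submodule Z R W" "Y \<subseteq> Z" "Z \<subseteq> S" "v \<in> Z" using step[OF Y(1-3) v] by (auto simp: Z_def)
    have "u \<notin> xW"
    proof
      assume "u \<in> xW"
      then have "fps_const 1 \<odot>\<^bsub>W\<^esub> u \<oplus>\<^bsub>W\<^esub> fps_const 0 \<odot>\<^bsub>W\<^esub> v \<in> xW"
        using uW W.smult_one[OF uW(1)] W.smult_l_null[OF uW(2)] by simp
      then show False using no by (metis zero_neq_one)
    qed
    moreover have "v \<notin> Y"
    proof
      assume "v \<in> Y"
      then obtain k s where ks: "v = fps_const k \<odot>\<^bsub>W\<^esub> u \<oplus>\<^bsub>W\<^esub> s" "s \<in> xW" by (auto simp: Y_def)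
      have sW: "s \<in> carrier W" using ks(2) xWE(1) by auto
      have "fps_const (- k) \<odot>\<^bsub>W\<^esub> u \<oplus>\<^bsub>W\<^esub> fps_const 1 \<odot>\<^bsub>W\<^esub> v = (fps_const (- k) \<odot>\<^bsub>W\<^esub> u \<oplus>\<^bsub>W\<^esub> fps_const k \<odot>\<^bsub>W\<^esub> u) \<oplus>\<^bsub>W\<^esub> s"
        using ks(1) uW sW in_R(7) W.smult_one[OF uW(2)] by (simp add: W.M.a_assoc)
      also have "fps_const (- k) \<odot>\<^bsub>W\<^esub> u \<oplus>\<^bsub>W\<^esub> fps_const k \<odot>\<^bsub>W\<^esub> u = (fps_const (- k) + fps_const k) \<odot>\<^bsub>W\<^esub> u"
        using W.smult_l_distr[OF in_R(7)[of "- k"] in_R(7)[of k] uW(1)] by (simp only: R_add)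
      also have "\<dots> = \<zero>\<^bsub>W\<^esub>" using W.smult_l_null[OF uW(1)] by simp
      finally have "fps_const (- k) \<odot>\<^bsub>W\<^esub> u \<oplus>\<^bsub>W\<^esub> fps_const 1 \<odot>\<^bsub>W\<^esub> v \<in> xW" using ks(2) sW by simp
      then show False using no by (metis zero_neq_one)
    qed
    ultimately have "xW \<subset> Y" "Y \<subset> Z" using Y Z u v by blast+
    then have "\<forall>i<2. (if i = 0 then xW else if i = 1 then Y else Z) \<subset> (if Suc i = 0 then xW else if Suc i = 1 then Y else Z)"
      by (auto simp: less_Suc_eq numeral_2_eq_2)
    moreover have "\<forall>i\<le>2. submodule (if i = 0 then xW else if i = 1 then Y else Z) R W \<and>
        xW \<subseteq> (if i = 0 then xW else if i = 1 then Y else Z) \<and> (if i = 0 then xW else if i = 1 then Y else Z) \<subseteq> S" for i :: nat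
      using xW Y Z xW_S by auto
    ultimately have "enat 2 \<le> quot_length R W xW S"
      unfolding quot_length_def
      by (intro Sup_upper CollectI exI[of _ 2] exI[of _ "\<lambda>i. if i = 0 then xW else if i = 1 then Y else Z"] conjI refl)
    then show False using len by (simp add: one_enat_def)
  qed
  show ?thesis
  proof (intro type_one_module.intro type_one_module_axioms.intro)
    show "numerical_semigroup_ring H R" by (rule numerical_semigroup_ring_axioms)
    show "plain_module R W" by (rule W.plain_module_axioms)
    show "a \<in> carrier R \<Longrightarrow> v \<in> carrier W \<Longrightarrow> a \<odot>\<^bsub>W\<^esub> v = \<zero>\<^bsub>W\<^esub> \<Longrightarrow> a = 0 \<or> v = \<zero>\<^bsub>W\<^esub>" for a v by (rule tf)
  next
    fix z u v
    assume z: "z \<in> max_ideal R" "z \<noteq> 0" and uv: "u \<in> carrier W" "v \<in> carrier W"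
      and soc: "\<And>a. a \<in> max_ideal R \<Longrightarrow> a \<odot>\<^bsub>W\<^esub> u \<in> (\<lambda>v. z \<odot>\<^bsub>W\<^esub> v) ` carrier W"
        "\<And>a. a \<in> max_ideal R \<Longrightarrow> a \<odot>\<^bsub>W\<^esub> v \<in> (\<lambda>v. z \<odot>\<^bsub>W\<^esub> v) ` carrier W"
    have zR: "z \<in> carrier R" using z by (simp add: max_ideal_iff)
    have swap: "a \<odot>\<^bsub>W\<^esub> (b \<odot>\<^bsub>W\<^esub> t) = b \<odot>\<^bsub>W\<^esub> (a \<odot>\<^bsub>W\<^esub> t)" if "a \<in> carrier R" "b \<in> carrier R" "t \<in> carrier W" for a b t
      using that by (simp add: mult.commute flip: sm)
    \<comment> \<open>As \<open>x\<close> is in the maximal ideal, \<open>x u\<close> is a multiple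
      \<open>z t\<close>; cancelling \<open>z\<close> shows that \<open>t\<close> is a socle element
      modulo \<open>x\<close>.\<close>
    have transfer: "\<exists>t\<in>S. x \<odot>\<^bsub>W\<^esub> u = z \<odot>\<^bsub>W\<^esub> t" if uW: "u \<in> carrier W"
      and soc: "\<And>a. a \<in> max_ideal R \<Longrightarrow> a \<odot>\<^bsub>W\<^esub> u \<in> (\<lambda>v. z \<odot>\<^bsub>W\<^esub> v) ` carrier W" for u
    proof -
      obtain t where t: "t \<in> carrier W" "x \<odot>\<^bsub>W\<^esub> u = z \<odot>\<^bsub>W\<^esub> t" using soc[OF x(1)] by auto
      have "a \<odot>\<^bsub>W\<^esub> t \<in> xW" if a: "a \<in> max_ideal R" for a
      proof -
        have aR: "a \<in> carrier R" using a by (simp add: max_ideal_iff)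
        obtain t' where t': "t' \<in> carrier W" "a \<odot>\<^bsub>W\<^esub> u = z \<odot>\<^bsub>W\<^esub> t'" using soc[OF a] by auto
        have "z \<odot>\<^bsub>W\<^esub> (a \<odot>\<^bsub>W\<^esub> t) = a \<odot>\<^bsub>W\<^esub> (x \<odot>\<^bsub>W\<^esub> u)" using swap[OF zR aR t(1)] t(2) by simp
        also have "\<dots> = x \<odot>\<^bsub>W\<^esub> (z \<odot>\<^bsub>W\<^esub> t')" using swap[OF aR x(2) uW] t'(2) by simp
        also have "\<dots> = z \<odot>\<^bsub>W\<^esub> (x \<odot>\<^bsub>W\<^esub> t')" using swap[OF x(2) zR t'(1)] .
        finally have "a \<odot>\<^bsub>W\<^esub> t = x \<odot>\<^bsub>W\<^esub> t'" using cancel[OF zR z(2)] aR t(1) t'(1) x(2) by simp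
        then show ?thesis using t'(1) by (auto simp: xW_def)
      qed
      then show ?thesis using t by (auto simp: S_def)
    qed
    obtain s t where st: "s \<in> S" "t \<in> S" "x \<odot>\<^bsub>W\<^esub> u = z \<odot>\<^bsub>W\<^esub> s" "x \<odot>\<^bsub>W\<^esub> v = z \<odot>\<^bsub>W\<^esub> t"
      using transfer[OF uv(1) soc(1)] transfer[OF uv(2) soc(2)] by auto
    have stW: "s \<in> carrier W" "t \<in> carrier W" using st by (auto simp: S_def)
    obtain k l where kl: "k \<noteq> 0 \<or> l \<noteq> 0" "fps_const k \<odot>\<^bsub>W\<^esub> s \<oplus>\<^bsub>W\<^esub> fps_const l \<odot>\<^bsub>W\<^esub> t \<in> xW"
      using soc_x[OF st(1,2)] by auto
    then obtain r where r: "r \<in> carrier W" "fps_const k \<odot>\<^bsub>W\<^esub> s \<oplus>\<^bsub>W\<^esub> fps_const l \<odot>\<^bsub>W\<^esub> t = x \<odot>\<^bsub>W\<^esub> r" by (auto simp: xW_def)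
    \<comment> \<open>The relation modulo \<open>x\<close> between \<open>s\<close> and
      \<open>t\<close> becomes one modulo \<open>z\<close> between \<open>u\<close> and
      \<open>v\<close> after cancelling \<open>x\<close>.\<close>
    have "x \<odot>\<^bsub>W\<^esub> (fps_const k \<odot>\<^bsub>W\<^esub> u \<oplus>\<^bsub>W\<^esub> fps_const l \<odot>\<^bsub>W\<^esub> v) = fps_const k \<odot>\<^bsub>W\<^esub> (x \<odot>\<^bsub>W\<^esub> u) \<oplus>\<^bsub>W\<^esub> fps_const l \<odot>\<^bsub>W\<^esub> (x \<odot>\<^bsub>W\<^esub> v)"
      using x(2) uv in_R(7) by (simp add: W.smult_r_distr mult.commute flip: sm)
    also have "\<dots> = z \<odot>\<^bsub>W\<^esub> (fps_const k \<odot>\<^bsub>W\<^esub> s \<oplus>\<^bsub>W\<^esub> fps_const l \<odot>\<^bsub>W\<^esub> t)"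
      unfolding st(3,4) using zR stW in_R(7) by (simp add: W.smult_r_distr mult.commute flip: sm)
    also have "\<dots> = x \<odot>\<^bsub>W\<^esub> (z \<odot>\<^bsub>W\<^esub> r)" unfolding r(2) by (rule swap[OF zR x(2) r(1)])
    finally have "fps_const k \<odot>\<^bsub>W\<^esub> u \<oplus>\<^bsub>W\<^esub> fps_const l \<odot>\<^bsub>W\<^esub> v = z \<odot>\<^bsub>W\<^esub> r"
      using cancel[OF x(2) x_nz] uv r(1) zR in_R(7) by simp
    then show "\<exists>k l. (k \<noteq> 0 \<or> l \<noteq> 0) \<and>
        fps_const k \<odot>\<^bsub>W\<^esub> u \<oplus>\<^bsub>W\<^esub> fps_const l \<odot>\<^bsub>W\<^esub> v \<in> (\<lambda>v. z \<odot>\<^bsub>W\<^esub> v) ` carrier W"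
      using kl(1) r(1) by blast
  qed
qed

text \<open>For \<open>n < c\<close> the factor \<open>fps_X ^ (c - 1 - n)\<close> leads to the gap
  \<open>c - 1\<close>; from order \<open>c\<close> on every series is in \<open>R\<close>.\<close>

lemma monom_in_conductor: "fps_to_fls (fps_X ^ n) \<in> conductor R \<longleftrightarrow> n \<ge> c"
proof
  assume "fps_to_fls (fps_X ^ n) \<in> conductor R"
  then have "\<forall>f :: 'k fps. fps_to_fls (fps_X ^ n * f) \<in> fps_to_fls ` carrier R"
    by (simp add: conductor_def fls_times_fps_to_fls)
  then have *: "fps_X ^ n * f \<in> carrier R" for f :: "'k fps" by (metis (no_types, lifting) fps_to_fls_eq_iff imageE)
  show "n \<ge> c"
  proof (rule ccontr)
    assume "\<not> n \<ge> c"
    then have "n + (c - 1 - n) + 1 = c" by simp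
    moreover have "n + (c - 1 - n) \<in> H" using *[of "fps_X ^ (c - 1 - n)"] by (simp add: monom_in_R flip: power_add)
    ultimately show False using c_pred by blast
  qed
next
  assume n: "n \<ge> c"
  have "fps_X ^ n * f \<in> carrier R" for f :: "'k fps"
    using n by (intro high_in_R) (simp add: fps_X_power_mult_nth)
  moreover from this[of 1] have "fps_to_fls (fps_X ^ n) \<in> fraction_field R"
    unfolding fraction_field_def using in_R(2)
    by (intro CollectI exI[of _ "fps_X ^ n"] exI[of _ 1]) auto
  ultimately show "fps_to_fls (fps_X ^ n) \<in> conductor R"
    by (auto simp: conductor_def simp flip: fls_times_fps_to_fls)
qed

text \<open>For \<open>z < c\<close> the hypothesis at \<open>n = c - 1 - z\<close> yields
  \<open>k\<close> in \<open>KK\<close> with \<open>c - 1 - (z - k)\<close> outside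
  \<open>H\<close>, which by duality means that \<open>z - k\<close> is in
  \<open>KK\<close>.\<close>

lemma KK_add_KK:
  assumes *: "\<And>n. (\<And>k. k \<in> KK \<Longrightarrow> n + k \<in> H) \<Longrightarrow> n \<ge> c"
  shows "\<exists>k\<in>KK. \<exists>l\<in>KK. z = k + l"
proof (cases "z < c")
  case True
  then have "\<not> c - 1 - z \<ge> c" by simp
  then obtain k where k: "k \<in> KK" "c - 1 - z + k \<notin> H" using *[of "c - 1 - z"] by blast
  have kz: "k \<le> z"
  proof (rule ccontr)
    assume "\<not> k \<le> z"
    then have "c \<le> c - 1 - z + k" using True by linarith
    then show False using k(2) ge_c by blast
  qed
  then have "c - 1 - (z - k) = c - 1 - z + k" using True by simp
  then have "z - k \<in> KK" using k(2) notin_KK[of "z - k"] by auto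
  then show ?thesis using k(1) kz by (metis le_add_diff_inverse)
next
  case False
  then show ?thesis using zero_in_KK ge_c_in_KK[of z] by (metis add_0 not_less)
qed

end

theorem corollary5p3:
  fixes H :: "nat set"
    and R :: "('k::field) fps ring"
    and W :: "('k fps, 'm) module"
  assumes "numerical_semigroup H"
    and "R = semigroup_ring H"
    and "canonical_module TYPE('e) R W"
    and "far_flung_Gorenstein R W"
  shows "multiplicity_of_ring R \<le> real_of_int (rohrbach_max (the_enat (cm_type R (ring_module R))))"
proof -
  interpret numerical_semigroup_ring H R using assms(1,2) by (rule numerical_semigroup_ring.intro)
  have W: "maximal_CM_module R W" "cm_type R W = 1" using assms(3) by (auto simp: canonical_module_def)
  interpret W: type_one_module H R W using W by (rule type_one_module_of_canonical)
  have tr: "fps_to_fls ` module_trace R W = conductor R" using assms(4) by (simp add: far_flung_Gorenstein_def)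
  have trace_iff: "fps_X ^ n \<in> module_trace R W \<longleftrightarrow> n \<ge> c" for n
    using tr monom_in_conductor[of n] by (metis (no_types, lifting) fps_to_fls_eq_iff imageE imageI)
  \<comment> \<open>If all maps to \<open>R\<close> vanished, the trace would be zero, but it
    contains \<open>fps_X ^ c\<close>.\<close>
  have "\<exists>f\<in>mod_hom R W (ring_module R). \<exists>w\<in>carrier W. f w \<noteq> 0"
  proof (rule ccontr)
    assume "\<not> ?thesis"
    then have "(\<Union>f\<in>mod_hom R W (ring_module R). f ` carrier W) \<subseteq> {0}" by auto
    then have "module_trace R W \<subseteq> {0}"
      unfolding module_trace_def using zeroideal by (intro genideal_minimal) auto
    moreover have "fps_X ^ c \<in> module_trace R W" using trace_iff by simp
    ultimately show False by (auto dest!: subsetD)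
  qed
  then obtain f w where f: "f \<in> mod_hom R W (ring_module R)" "w \<in> carrier W" "f w \<noteq> 0" by blast
  have "fin_gen R W" using W(1) by (simp add: maximal_CM_module_def)
  \<comment> \<open>Such an \<open>n\<close> puts \<open>fps_X ^ n\<close> in the trace, which is
    the conductor.\<close>
  then have "n \<ge> c" if "\<And>k. k \<in> KK \<Longrightarrow> n + k \<in> H" for n
    using W.monom_in_trace[OF _ f that] trace_iff by blast
  then have "\<exists>k\<in>KK. \<exists>l\<in>KK. z = k + l" for z by (rule KK_add_KK)
  then have "int e \<le> rohrbach_max (the_enat (cm_type R (ring_module R)))"
    by (rule e_le_rohrbach)
  then show ?thesis unfolding multiplicity_eq by linarith
qed

end
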